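(* Let $G=(V,E)$ be a finite connected simple graph with edges $e_1,\dots,e_m$, $m\ge 1$, and let $X_0=\langle w_{e_1}(0),\dots,w_{e_m}(0)\rangle$ be a vector of strictly positive initial edge weights with $\sum_{i=1}^m w_{e_i}(0)=1$. Consider the initial value problem (unnormalized Ricci flow) for $X(t)=\langle w_{e_1}(t),\dots,w_{e_m}(t)\rangle$ with $w_{e_i}(t)>0$: $$\frac{dw_e}{dt}(t)=-\kappa_e(t)\,w_e(t)\quad (e\in E),\qquad X(0)=X_0,$$ where $\kappa_e(t)$ is the Ollivier-Lin-Lu-Yau curvature of the edge $e$ in the weighted graph $(V,E,w(t))$. Assume that each edge is always a shortest path between its endpoints along the flow, i.e. for every $T\in(0,\infty]$, every solution $X:[0,T)\to(0,\infty)^m$ of this problem, every $t\in[0,T)$ and every edge $uv\in E$, one has $w_{uv}(t)=d_t(u,v)$, where $d_t$ is the weighted shortest-path distance determined by $w(t)$. Then there exists a unique solution $X(t)$ of the initial value problem defined for all $t\in[0,\infty)$.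
   Context: Weighted graph: $G=(V,E,w)$ with $w_{xy}>0$ for each edge $xy\in E$. The length of a path is the sum of the weights of its edges, and $d(x,y)$ is the minimal length of a path joining $x$ and $y$. Write $x\sim y$ if $xy\in E$. Fix a function $\gamma:\mathbb{R}_+\to\mathbb{R}_+$ (positive-valued on positive reals) that is one-to-one, is such that the curvature defined below is invariant under scaling of the metric (multiplying all weights by a common positive constant), and is Lipschitz on $[\delta,1]$ for every $\delta>0$. For $\alpha\in[0,1]$ and $x\in V$, let $\mu_x^\alpha$ be the probability distribution on $V$ with $\mu_x^\alpha(x)=\alpha$, $\mu_x^\alpha(y)=(1-\alpha)\dfrac{\gamma(w_{xy})}{\sum_{z\sim x}\gamma(w_{xz})}$ if $y\sim x$, and $\mu_x^\alpha(y)=0$ otherwise. Let $W(\mu_1,\mu_2)=\inf_A\sum_{x,y\in V}A(x,y)d(x,y)$, the infimum being over all couplings $A$ of $\mu_1$ and $\mu_2$. For $x\ne y$ set $\kappa_\alpha(x,y)=1-\dfrac{W(\mu_x^\alpha,\mu_y^\alpha)}{d(x,y)}$. The Ollivier-Lin-Lu-Yau curvature is $\kappa(x,y)=\lim_{\alpha\to1}\dfrac{\kappa_\alpha(x,y)}{1-\alpha}$. For an edge $e=xy$, $\kappa_e=\kappa(x,y)$; $\kappa_e(t)$ denotes this quantity computed with the weights $w(t)$. A solution on an interval $[0,T)$ is a differentiable function (one-sided derivative at $0$) with values in $(0,\infty)^m$ satisfying the system and the initial condition. *)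

theory Defs
  imports "HOL-Analysis.Analysis"
begin

text \<open>
  A simple graph is a vertex set \<open>V\<close> with a set \<open>E\<close> of two-element subsets of \<open>V\<close>. Weights are
  functions on sets of vertices, of which only the values on members of \<open>E\<close> matter.
\<close>

definition simple_graph :: "'a set \<Rightarrow> 'a set set \<Rightarrow> bool" where
  "simple_graph V E \<longleftrightarrow> (\<forall>e\<in>E. e \<subseteq> V \<and> card e = 2)"

definition joining_path :: "'a set set \<Rightarrow> 'a \<Rightarrow> 'a \<Rightarrow> 'a list \<Rightarrow> bool" where
  "joining_path E x y p \<longleftrightarrow>
     p \<noteq> [] \<and> hd p = x \<and> last p = y \<and> distinct p \<and> successively (\<lambda>u v. {u, v} \<in> E) p"

definition connected_graph :: "'a set \<Rightarrow> 'a set set \<Rightarrow> bool" where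
  "connected_graph V E \<longleftrightarrow> (\<forall>x\<in>V. \<forall>y\<in>V. \<exists>p. joining_path E x y p)"

definition finite_connected_simple_graph :: "'a set \<Rightarrow> 'a set set \<Rightarrow> bool" where
  "finite_connected_simple_graph V E \<longleftrightarrow> finite V \<and> simple_graph V E \<and> connected_graph V E"

definition path_weight :: "('a set \<Rightarrow> real) \<Rightarrow> 'a list \<Rightarrow> real" where
  "path_weight w p = (\<Sum>(u, v) \<leftarrow> zip p (tl p). w {u, v})"

text \<open>In a finite connected graph there are finitely many, and at least one, joining paths.\<close>

definition wdist :: "'a set set \<Rightarrow> ('a set \<Rightarrow> real) \<Rightarrow> 'a \<Rightarrow> 'a \<Rightarrow> real" where
  "wdist E w x y = Min (path_weight w ` {p. joining_path E x y p})"

definition walk_measure ::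
  "(real \<Rightarrow> real) \<Rightarrow> 'a set set \<Rightarrow> ('a set \<Rightarrow> real) \<Rightarrow> real \<Rightarrow> 'a \<Rightarrow> 'a \<Rightarrow> real" where
  "walk_measure \<gamma> E w \<alpha> x y =
     (if y = x then \<alpha>
      else if {x, y} \<in> E
      then (1 - \<alpha>) * (\<gamma> (w {x, y}) / (\<Sum>z | {x, z} \<in> E. \<gamma> (w {x, z})))
      else 0)"

definition coupling :: "'a set \<Rightarrow> ('a \<Rightarrow> real) \<Rightarrow> ('a \<Rightarrow> real) \<Rightarrow> ('a \<Rightarrow> 'a \<Rightarrow> real) \<Rightarrow> bool" where
  "coupling V \<mu> \<nu> A \<longleftrightarrow>
     (\<forall>x\<in>V. \<forall>y\<in>V. 0 \<le> A x y) \<and>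
     (\<forall>x\<in>V. (\<Sum>y\<in>V. A x y) = \<mu> x) \<and>
     (\<forall>y\<in>V. (\<Sum>x\<in>V. A x y) = \<nu> y)"

definition wasserstein ::
  "'a set \<Rightarrow> 'a set set \<Rightarrow> ('a set \<Rightarrow> real) \<Rightarrow> ('a \<Rightarrow> real) \<Rightarrow> ('a \<Rightarrow> real) \<Rightarrow> real" where
  "wasserstein V E w \<mu> \<nu> =
     (INF A \<in> {A. coupling V \<mu> \<nu> A}. \<Sum>x\<in>V. \<Sum>y\<in>V. A x y * wdist E w x y)"

definition alpha_curvature ::
  "(real \<Rightarrow> real) \<Rightarrow> 'a set \<Rightarrow> 'a set set \<Rightarrow> ('a set \<Rightarrow> real) \<Rightarrow> real \<Rightarrow> 'a \<Rightarrow> 'a \<Rightarrow> real" where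
  "alpha_curvature \<gamma> V E w \<alpha> x y =
     1 - wasserstein V E w (walk_measure \<gamma> E w \<alpha> x) (walk_measure \<gamma> E w \<alpha> y) / wdist E w x y"

text \<open>Since \<open>\<alpha>\<close> ranges over \<open>[0, 1]\<close>, the limit \<open>\<alpha> \<rightarrow> 1\<close> is a left limit.\<close>

definition olly_curvature ::
  "(real \<Rightarrow> real) \<Rightarrow> 'a set \<Rightarrow> 'a set set \<Rightarrow> ('a set \<Rightarrow> real) \<Rightarrow> 'a \<Rightarrow> 'a \<Rightarrow> real" where
  "olly_curvature \<gamma> V E w x y =
     Lim (at_left 1) (\<lambda>\<alpha>. alpha_curvature \<gamma> V E w \<alpha> x y / (1 - \<alpha>))"

text \<open>
  The interval \<open>[0, T)\<close>, where \<open>T = \<infinity>\<close> is allowed. The derivative within it is one-sided at \<open>0\<close>.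
\<close>

definition time_interval :: "ereal \<Rightarrow> real set" where
  "time_interval T = {t. 0 \<le> t \<and> ereal t < T}"

definition ricci_flow_solution ::
  "(real \<Rightarrow> real) \<Rightarrow> 'a set \<Rightarrow> 'a set set \<Rightarrow> ('a set \<Rightarrow> real) \<Rightarrow> ereal \<Rightarrow>
   (real \<Rightarrow> 'a set \<Rightarrow> real) \<Rightarrow> bool" where
  "ricci_flow_solution \<gamma> V E w\<^sub>0 T X \<longleftrightarrow>
     (\<forall>e\<in>E. X 0 e = w\<^sub>0 e) \<and>
     (\<forall>t\<in>time_interval T. \<forall>e\<in>E. 0 < X t e) \<and>
     (\<forall>t\<in>time_interval T. \<forall>x y. {x, y} \<in> E \<longrightarrow>
        ((\<lambda>s. X s {x, y}) has_real_derivative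
           - olly_curvature \<gamma> V E (X t) x y * X t {x, y}) (at t within time_interval T))"

end

theory Submission
  imports Defs
begin

text \<open>
  The curvature of an edge \<open>xy\<close> needs no limit. For \<open>1/2 \<le> \<alpha> < 1\<close> every coupling of the walks at
  \<open>x\<close> and \<open>y\<close> with idleness \<open>\<alpha>\<close> is the mixture of a coupling at idleness \<open>1/2\<close> with a
  point mass at \<open>(x, y)\<close>. Hence the transport cost is affine in \<open>\<alpha>\<close>, and
  \<open>\<kappa>(x, y) = 2 (1 - W / d(x, y))\<close> with \<open>W\<close> the cost at idleness \<open>1/2\<close>
  (\<open>olly_curvature_eq\<close>). Everything is read off from this formula.

  Local Lipschitz continuity: a distance is a minimum of finitely many sums of weights, the walk
  measures are quotients built from \<open>\<gamma>\<close> and the weights, and an optimal transport cost depends in a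
  Lipschitz way on its cost function and on its two marginals (\<open>optimal_cost_perturb\<close>). The
  Lipschitz bound for \<open>\<gamma>\<close> on \<open>[\<delta>, 1]\<close> covers weights up to \<open>1\<close>; scale invariance of the
  curvature carries the result to weights in any compact subset of the positive reals
  (\<open>flow_field_lipschitz\<close>).

  A priori bounds: \<open>W \<ge> 0\<close> gives \<open>\<kappa> \<le> 2\<close>, so a weight decays no faster than
  \<open>exp (-2 t)\<close>. If each edge is a shortest path, then \<open>w = d\<close> on edges and
  \<open>- \<kappa> w = 2 W - 2 w\<close>, where \<open>W\<close> is at most the diameter, hence at most a constant times the
  total weight. So the total weight grows at most exponentially (\<open>solution_bounds\<close>), and on a
  bounded time interval every solution stays in a compact box of positive weights.

  Uniqueness then follows from a Gronwall estimate on that box. For existence on \<open>[0, T)\<close>, the field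
  composed with the clamping of the weights to a slightly larger box is globally Lipschitz, and Picard
  iteration solves the equation for it. Up to its first exit from the larger box that solution solves
  the original equation, so it obeys the a priori bounds, and these prevent the exit. By uniqueness
  the solutions for different \<open>T\<close> fit together to one on \<open>[0, \<infinity>)\<close>.
\<close>

section \<open>Optimal transport on a finite set\<close>

definition prob_on :: "'a set \<Rightarrow> ('a \<Rightarrow> real) \<Rightarrow> bool" where
  "prob_on V \<mu> \<longleftrightarrow> (\<forall>x\<in>V. 0 \<le> \<mu> x) \<and> sum \<mu> V = 1"

definition transport_cost :: "'a set \<Rightarrow> ('a \<Rightarrow> 'a \<Rightarrow> real) \<Rightarrow> ('a \<Rightarrow> 'a \<Rightarrow> real) \<Rightarrow> real" where
  "transport_cost V c A = (\<Sum>x\<in>V. \<Sum>y\<in>V. A x y * c x y)"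

definition optimal_cost ::
  "'a set \<Rightarrow> ('a \<Rightarrow> 'a \<Rightarrow> real) \<Rightarrow> ('a \<Rightarrow> real) \<Rightarrow> ('a \<Rightarrow> real) \<Rightarrow> real" where
  "optimal_cost V c \<mu> \<nu> = (INF A \<in> {A. coupling V \<mu> \<nu> A}. transport_cost V c A)"

lemma wasserstein_eq_optimal_cost:
  "wasserstein V E w \<mu> \<nu> = optimal_cost V (wdist E w) \<mu> \<nu>"
  by (simp add: wasserstein_def optimal_cost_def transport_cost_def)

lemma product_coupling:
  assumes "prob_on V \<mu>" "prob_on V \<nu>"
  shows "coupling V \<mu> \<nu> (\<lambda>x y. \<mu> x * \<nu> y)"
  using assms unfolding coupling_def prob_on_def
  by (auto simp flip: sum_distrib_left sum_distrib_right)

lemma coupling_total: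
  assumes "prob_on V \<mu>" "coupling V \<mu> \<nu> A"
  shows "(\<Sum>x\<in>V. \<Sum>y\<in>V. A x y) = 1"
  using assms by (simp add: coupling_def prob_on_def)

lemma coupling_le_one:
  assumes "finite V" "prob_on V \<mu>" "coupling V \<mu> \<nu> A" "x \<in> V" "y \<in> V"
  shows "A x y \<le> 1"
proof -
  have "A x y \<le> (\<Sum>y\<in>V. A x y)"
    using assms by (intro member_le_sum) (auto simp: coupling_def)
  also have "\<dots> = \<mu> x"
    using assms by (simp add: coupling_def)
  also have "\<dots> \<le> sum \<mu> V"
    using assms by (intro member_le_sum) (auto simp: prob_on_def)
  finally show ?thesis
    using assms by (simp add: prob_on_def)
qed

lemma transport_cost_nonneg:
  assumes "coupling V \<mu> \<nu> A" "\<And>x y. \<lbrakk>x \<in> V; y \<in> V\<rbrakk> \<Longrightarrow> 0 \<le> c x y"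
  shows "0 \<le> transport_cost V c A"
  using assms unfolding transport_cost_def coupling_def by (auto intro!: sum_nonneg)

lemma transport_cost_le:
  assumes "prob_on V \<mu>" "coupling V \<mu> \<nu> A" "\<And>x y. \<lbrakk>x \<in> V; y \<in> V\<rbrakk> \<Longrightarrow> c x y \<le> D"
  shows "transport_cost V c A \<le> D"
proof -
  have "transport_cost V c A \<le> (\<Sum>x\<in>V. \<Sum>y\<in>V. A x y * D)"
    unfolding transport_cost_def using assms
    by (intro sum_mono mult_left_mono) (auto simp: coupling_def)
  also have "\<dots> = D"
    using coupling_total[OF assms(1,2)] by (simp flip: sum_distrib_right)
  finally show ?thesis .
qed

lemma transport_cost_diff_le:
  assumes "finite V" "prob_on V \<mu>" "coupling V \<mu> \<nu> A"
  shows "transport_cost V c' A \<le> transport_cost V c A + (\<Sum>x\<in>V. \<Sum>y\<in>V. \<bar>c x y - c' x y\<bar>)"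
proof -
  have "A x y * c' x y \<le> A x y * c x y + \<bar>c x y - c' x y\<bar>" if "x \<in> V" "y \<in> V" for x y
  proof -
    have "A x y * (c' x y - c x y) \<le> 1 * \<bar>c x y - c' x y\<bar>"
    proof (rule order_trans)
      show "A x y * (c' x y - c x y) \<le> A x y * \<bar>c x y - c' x y\<bar>"
        using assms that by (intro mult_left_mono) (auto simp: coupling_def)
      show "A x y * \<bar>c x y - c' x y\<bar> \<le> 1 * \<bar>c x y - c' x y\<bar>"
        using coupling_le_one[OF assms that] by (intro mult_right_mono) auto
    qed
    then show ?thesis by (simp add: algebra_simps)
  qed
  then show ?thesis
    unfolding transport_cost_def sum.distrib[symmetric] by (intro sum_mono) auto
qed

lemma optimal_cost_le:
  assumes "coupling V \<mu> \<nu> A" "\<And>x y. \<lbrakk>x \<in> V; y \<in> V\<rbrakk> \<Longrightarrow> 0 \<le> c x y"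
  shows "optimal_cost V c \<mu> \<nu> \<le> transport_cost V c A"
  unfolding optimal_cost_def
proof (rule cINF_lower)
  show "bdd_below (transport_cost V c ` {A. coupling V \<mu> \<nu> A})"
    using assms(2) by (intro bdd_belowI2[where m = 0]) (auto intro: transport_cost_nonneg)
qed (use assms in simp)

lemma optimal_cost_greatest:
  assumes "prob_on V \<mu>" "prob_on V \<nu>"
    and "\<And>A. coupling V \<mu> \<nu> A \<Longrightarrow> m \<le> transport_cost V c A"
  shows "m \<le> optimal_cost V c \<mu> \<nu>"
  unfolding optimal_cost_def
  using product_coupling[OF assms(1,2)] assms(3) by (intro cINF_greatest) auto

lemma optimal_cost_commute:
  assumes "prob_on V \<mu>" "prob_on V \<nu>"
    and "\<And>x y. \<lbrakk>x \<in> V; y \<in> V\<rbrakk> \<Longrightarrow> c x y = c y x"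
    and "\<And>x y. \<lbrakk>x \<in> V; y \<in> V\<rbrakk> \<Longrightarrow> 0 \<le> c x y"
  shows "optimal_cost V c \<mu> \<nu> = optimal_cost V c \<nu> \<mu>"
proof -
  have flip: "optimal_cost V c \<mu> \<nu> \<le> optimal_cost V c \<nu> \<mu>"
    if "prob_on V \<mu>" "prob_on V \<nu>" for \<mu> \<nu>
  proof (rule optimal_cost_greatest[OF that(2,1)])
    fix A assume A: "coupling V \<nu> \<mu> A"
    have "optimal_cost V c \<mu> \<nu> \<le> transport_cost V c (\<lambda>x y. A y x)"
      using A assms(4) by (intro optimal_cost_le) (auto simp: coupling_def)
    also have "\<dots> = transport_cost V c A"
      unfolding transport_cost_def
      by (subst sum.swap, intro sum.cong refl) (simp add: assms(3))
    finally show "optimal_cost V c \<mu> \<nu> \<le> transport_cost V c A" .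
  qed
  show ?thesis
    using flip[of \<mu> \<nu>] flip[of \<nu> \<mu>] assms by auto
qed

text \<open>
  Moving the marginals costs no more than their \<open>l\<^sup>1\<close> distance times the largest cost:
  thin \<open>A\<close> in each row and each column until its marginals lie below the new ones, then transport the
  missing mass \<open>a\<close>, \<open>b\<close> by the normalised product of these two defects.
\<close>

lemma recoupling:
  assumes "finite V" "prob_on V \<mu>" "prob_on V \<nu>" "prob_on V \<mu>'" "prob_on V \<nu>'"
    and A: "coupling V \<mu> \<nu> A"
    and c: "\<And>x y. \<lbrakk>x \<in> V; y \<in> V\<rbrakk> \<Longrightarrow> 0 \<le> c x y \<and> c x y \<le> D"
  obtains A' where "coupling V \<mu>' \<nu>' A'"
    "transport_cost V c A' \<le> transport_cost V c A +
       D * ((\<Sum>x\<in>V. \<bar>\<mu> x - \<mu>' x\<bar>) + (\<Sum>y\<in>V. \<bar>\<nu> y - \<nu>' y\<bar>))"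
proof -
  have pos: "0 \<le> A x y" if "x \<in> V" "y \<in> V" for x y
    using A that by (auto simp: coupling_def)
  have row: "(\<Sum>y\<in>V. A x y) = \<mu> x" if "x \<in> V" for x
    using A that by (auto simp: coupling_def)
  have col: "(\<Sum>x\<in>V. A x y) = \<nu> y" if "y \<in> V" for y
    using A that by (auto simp: coupling_def)
  \<comment> \<open>If \<open>\<mu> x = 0\<close>, the quotient is \<open>0\<close>; row \<open>x\<close> of \<open>A\<close> then vanishes, so the factor is harmless.\<close>
  define r where "r x = min 1 (\<mu>' x / \<mu> x)" for x
  define s where "s y = min 1 (\<nu>' y / \<nu> y)" for y
  have r: "0 \<le> r x" "r x \<le> 1" "\<mu> x * r x = min (\<mu> x) (\<mu>' x)" if "x \<in> V" for x
    using that assms(2,4) by (auto simp: r_def prob_on_def min_def field_simps)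
  have s: "0 \<le> s y" "s y \<le> 1" "\<nu> y * s y = min (\<nu> y) (\<nu>' y)" if "y \<in> V" for y
    using that assms(3,5) by (auto simp: s_def prob_on_def min_def field_simps)
  define B where "B x y = A x y * (r x * s y)" for x y
  have B_nonneg: "0 \<le> B x y" if "x \<in> V" "y \<in> V" for x y
    unfolding B_def using that pos r(1) s(1) by simp
  have B_le_r: "B x y \<le> A x y * r x" and B_le_s: "B x y \<le> A x y * s y" and B_le: "B x y \<le> A x y"
    if "x \<in> V" "y \<in> V" for x y
  proof -
    show "B x y \<le> A x y * r x"
      unfolding B_def using that r s pos by (intro mult_left_mono mult_right_le_one_le) auto
    show "B x y \<le> A x y * s y"
      unfolding B_def using that r s pos by (intro mult_left_mono mult_left_le_one_le) auto
    show "B x y \<le> A x y"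
      unfolding B_def using that r s pos by (intro mult_right_le_one_le mult_le_one) auto
  qed
  define a where "a x = \<mu>' x - (\<Sum>y\<in>V. B x y)" for x
  define b where "b y = \<nu>' y - (\<Sum>x\<in>V. B x y)" for y
  have a_nonneg: "0 \<le> a x" if "x \<in> V" for x
  proof -
    have "(\<Sum>y\<in>V. B x y) \<le> (\<Sum>y\<in>V. A x y * r x)"
      using that B_le_r by (intro sum_mono) auto
    also have "\<dots> = min (\<mu> x) (\<mu>' x)"
      using that row r(3) by (simp flip: sum_distrib_right)
    finally show ?thesis by (simp add: a_def)
  qed
  have b_nonneg: "0 \<le> b y" if "y \<in> V" for y
  proof -
    have "(\<Sum>x\<in>V. B x y) \<le> (\<Sum>x\<in>V. A x y * s y)"
      using that B_le_s by (intro sum_mono) auto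
    also have "\<dots> = min (\<nu> y) (\<nu>' y)"
      using that col s(3) by (simp flip: sum_distrib_right)
    finally show ?thesis by (simp add: b_def)
  qed
  define t where "t = 1 - (\<Sum>x\<in>V. \<Sum>y\<in>V. B x y)"
  have sum_a: "sum a V = t"
    using assms(4) by (simp add: a_def t_def sum_subtractf prob_on_def)
  have sum_b: "sum b V = t"
    using assms(5) unfolding b_def t_def sum_subtractf prob_on_def
    by (subst sum.swap) simp
  have t_nonneg: "0 \<le> t"
    using a_nonneg sum_a by (metis sum_nonneg)
  have a0: "a x = 0" if "x \<in> V" "t = 0" for x
    using that sum_a a_nonneg assms(1) by (metis sum_nonneg_eq_0_iff)
  have b0: "b x = 0" if "x \<in> V" "t = 0" for x
    using that sum_b b_nonneg assms(1) by (metis sum_nonneg_eq_0_iff)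
  have t_le: "t \<le> (\<Sum>x\<in>V. \<bar>\<mu> x - \<mu>' x\<bar>) + (\<Sum>y\<in>V. \<bar>\<nu> y - \<nu>' y\<bar>)"
  proof -
    have "A x y - B x y \<le> A x y * (1 - r x) + A x y * (1 - s y)" if "x \<in> V" "y \<in> V" for x y
    proof -
      \<comment> \<open>This is the elementary \<open>1 - r s \<le> (1 - r) + (1 - s)\<close>.\<close>
      have "0 \<le> A x y * ((1 - r x) * (1 - s y))"
        using that pos r s by simp
      then show ?thesis by (simp add: B_def algebra_simps)
    qed
    then have "(\<Sum>x\<in>V. \<Sum>y\<in>V. A x y - B x y) \<le>
        (\<Sum>x\<in>V. \<Sum>y\<in>V. A x y * (1 - r x) + A x y * (1 - s y))"
      by (intro sum_mono) auto
    moreover have "(\<Sum>x\<in>V. \<Sum>y\<in>V. A x y - B x y) = t"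
      using coupling_total[OF assms(2) A] by (simp add: t_def sum_subtractf)
    moreover have "(\<Sum>x\<in>V. \<Sum>y\<in>V. A x y * (1 - r x) + A x y * (1 - s y)) =
        (\<Sum>x\<in>V. \<Sum>y\<in>V. A x y * (1 - r x)) + (\<Sum>y\<in>V. \<Sum>x\<in>V. A x y * (1 - s y))"
      by (simp add: sum.distrib) (rule sum.swap)
    moreover have "\<dots> = (\<Sum>x\<in>V. \<mu> x * (1 - r x)) + (\<Sum>y\<in>V. \<nu> y * (1 - s y))"
      using row col by (simp flip: sum_distrib_right)
    moreover have "\<dots> \<le> (\<Sum>x\<in>V. \<bar>\<mu> x - \<mu>' x\<bar>) + (\<Sum>y\<in>V. \<bar>\<nu> y - \<nu>' y\<bar>)"
      using r(3) s(3) by (intro add_mono sum_mono) (auto simp: right_diff_distrib min_def)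
    ultimately show ?thesis by linarith
  qed
  \<comment> \<open>For \<open>t = 0\<close> the quotient is \<open>0\<close>, which is right because \<open>a\<close> and \<open>b\<close> then vanish.\<close>
  define A' where "A' x y = B x y + a x * b y / t" for x y
  show thesis
  proof
    show "coupling V \<mu>' \<nu>' A'"
      unfolding coupling_def
    proof (intro conjI ballI)
      fix x y assume "x \<in> V" "y \<in> V"
      then show "0 \<le> A' x y"
        unfolding A'_def using B_nonneg a_nonneg b_nonneg t_nonneg by simp
    next
      fix x assume x: "x \<in> V"
      have "(\<Sum>y\<in>V. A' x y) = (\<Sum>y\<in>V. B x y) + a x * t / t"
        using sum_b by (simp add: A'_def sum.distrib flip: sum_divide_distrib sum_distrib_left)
      then show "(\<Sum>y\<in>V. A' x y) = \<mu>' x"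
        using a0[OF x] by (cases "t = 0") (auto simp: a_def)
    next
      fix y assume y: "y \<in> V"
      have "(\<Sum>x\<in>V. A' x y) = (\<Sum>x\<in>V. B x y) + t * b y / t"
        using sum_a by (simp add: A'_def sum.distrib flip: sum_divide_distrib sum_distrib_right)
      then show "(\<Sum>x\<in>V. A' x y) = \<nu>' y"
        using b0[OF y] by (cases "t = 0") (auto simp: b_def)
    qed
  next
    have D: "0 \<le> D"
    proof -
      have "V \<noteq> {}" using assms(2) by (auto simp: prob_on_def)
      then show ?thesis using c by (meson all_not_in_conv order_trans)
    qed
    have "transport_cost V c A' =
        (\<Sum>x\<in>V. \<Sum>y\<in>V. B x y * c x y) + (\<Sum>x\<in>V. \<Sum>y\<in>V. a x * b y / t * c x y)"
      by (simp add: transport_cost_def A'_def distrib_right sum.distrib)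
    also have "\<dots> \<le> (\<Sum>x\<in>V. \<Sum>y\<in>V. A x y * c x y) + (\<Sum>x\<in>V. \<Sum>y\<in>V. a x * b y / t * D)"
      using B_le c a_nonneg b_nonneg t_nonneg
      by (intro add_mono sum_mono mult_right_mono mult_left_mono) auto
    also have "(\<Sum>x\<in>V. \<Sum>y\<in>V. a x * b y / t * D) = D * t"
    proof -
      have "(\<Sum>x\<in>V. \<Sum>y\<in>V. a x * b y / t * D) = (\<Sum>x\<in>V. \<Sum>y\<in>V. a x * b y) * (D / t)"
        by (simp add: sum_distrib_right sum_divide_distrib)
      also have "\<dots> = sum a V * sum b V * (D / t)"
        by (simp only: sum_product)
      finally show ?thesis by (simp add: sum_a sum_b)
    qed
    also have "\<dots> \<le> D * ((\<Sum>x\<in>V. \<bar>\<mu> x - \<mu>' x\<bar>) + (\<Sum>y\<in>V. \<bar>\<nu> y - \<nu>' y\<bar>))"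
      using t_le D by (rule mult_left_mono)
    finally show "transport_cost V c A' \<le> transport_cost V c A +
       D * ((\<Sum>x\<in>V. \<bar>\<mu> x - \<mu>' x\<bar>) + (\<Sum>y\<in>V. \<bar>\<nu> y - \<nu>' y\<bar>))"
      by (simp add: transport_cost_def)
  qed
qed

lemma optimal_cost_perturb:
  assumes "finite V" "prob_on V \<mu>" "prob_on V \<nu>" "prob_on V \<mu>'" "prob_on V \<nu>'"
    and "\<And>x y. \<lbrakk>x \<in> V; y \<in> V\<rbrakk> \<Longrightarrow> 0 \<le> c x y \<and> c x y \<le> D"
    and "\<And>x y. \<lbrakk>x \<in> V; y \<in> V\<rbrakk> \<Longrightarrow> 0 \<le> c' x y"
  shows "optimal_cost V c' \<mu>' \<nu>' \<le> optimal_cost V c \<mu> \<nu> + (\<Sum>x\<in>V. \<Sum>y\<in>V. \<bar>c x y - c' x y\<bar>)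
     + D * ((\<Sum>x\<in>V. \<bar>\<mu> x - \<mu>' x\<bar>) + (\<Sum>y\<in>V. \<bar>\<nu> y - \<nu>' y\<bar>))"
    (is "_ \<le> _ + ?C + ?M")
proof -
  have "optimal_cost V c' \<mu>' \<nu>' - ?C - ?M \<le> optimal_cost V c \<mu> \<nu>"
  proof (rule optimal_cost_greatest[OF assms(2,3)])
    fix A assume A: "coupling V \<mu> \<nu> A"
    obtain A' where A': "coupling V \<mu>' \<nu>' A'"
        "transport_cost V c A' \<le> transport_cost V c A + ?M"
      by (rule recoupling[OF assms(1-5) A assms(6)])
    have "optimal_cost V c' \<mu>' \<nu>' \<le> transport_cost V c' A'"
      using A'(1) assms(7) by (rule optimal_cost_le)
    also have "\<dots> \<le> transport_cost V c A' + ?C"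
      using assms(1,4) A'(1) by (rule transport_cost_diff_le)
    finally show "optimal_cost V c' \<mu>' \<nu>' - ?C - ?M \<le> transport_cost V c A"
      using A'(2) by linarith
  qed
  then show ?thesis by linarith
qed

section \<open>Graph distance and the curvature formula\<close>

locale finite_graph =
  fixes V :: "'a set" and E :: "'a set set"
  assumes graph: "finite_connected_simple_graph V E"
begin

lemma finite_V: "finite V"
  and edge_subset: "e \<in> E \<Longrightarrow> e \<subseteq> V"
  and edge_card: "e \<in> E \<Longrightarrow> card e = 2"
  and connected: "\<lbrakk>x \<in> V; y \<in> V\<rbrakk> \<Longrightarrow> \<exists>p. joining_path E x y p"
  using graph
  by (auto simp: finite_connected_simple_graph_def simple_graph_def connected_graph_def)

lemma finite_E: "finite E"
  using finite_V edge_subset by (meson PowI finite_Pow_iff finite_subset subsetI)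

lemma edge_ends:
  assumes "{x, y} \<in> E"
  shows "x \<in> V" "y \<in> V" "x \<noteq> y"
  using edge_subset[OF assms] edge_card[OF assms] by auto

lemma neighbours: "{z. {x, z} \<in> E} \<subseteq> V - {x}" "finite {z. {x, z} \<in> E}"
proof -
  show "{z. {x, z} \<in> E} \<subseteq> V - {x}"
    using edge_ends by blast
  then show "finite {z. {x, z} \<in> E}"
    using finite_V by (meson finite_Diff finite_subset)
qed

definition path_edges :: "'a list \<Rightarrow> 'a set list" where
  "path_edges p = map (\<lambda>(u, v). {u, v}) (zip p (tl p))"

lemma path_weight_eq: "path_weight w p = sum_list (map w (path_edges p))"
  by (simp add: path_weight_def path_edges_def comp_def case_prod_unfold)

lemma path_edges_simps [simp]:
  "path_edges [] = []" "path_edges [u] = []"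
  "path_edges (u # v # p) = {u, v} # path_edges (v # p)"
  by (simp_all add: path_edges_def)

lemma path_edges_subset: "successively (\<lambda>u v. {u, v} \<in> E) p \<Longrightarrow> set (path_edges p) \<subseteq> E"
  by (induction p rule: induct_list012) auto

lemma joining_path_in_V:
  assumes "joining_path E x y p" "x \<in> V"
  shows "set p \<subseteq> V"
proof -
  have "\<lbrakk>successively (\<lambda>u v. {u, v} \<in> E) p; p \<noteq> []; hd p \<in> V\<rbrakk> \<Longrightarrow> set p \<subseteq> V" for p
    by (induction p rule: induct_list012) (auto dest: edge_ends)
  then show ?thesis
    using assms by (auto simp: joining_path_def)
qed

lemma finite_joining_paths:
  assumes "x \<in> V"
  shows "finite {p. joining_path E x y p}"
proof (rule finite_subset)
  show "{p. joining_path E x y p} \<subseteq> {p. set p \<subseteq> V \<and> distinct p}"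
    using joining_path_in_V assms by (auto simp: joining_path_def)
qed (rule finite_subset_distinct[OF finite_V])

lemma path_weight_rev:
  fixes p :: "'a list"
  shows "path_weight w (rev p) = path_weight w p"
proof -
  have snoc: "path_edges (p @ [u, v]) = path_edges (p @ [u]) @ [{u, v}]" for p :: "'a list" and u v
    by (induction p rule: induct_list012) auto
  have "path_edges (rev p) = rev (path_edges p)"
    by (induction p rule: induct_list012) (auto simp: snoc insert_commute)
  then show ?thesis
    by (simp add: path_weight_eq rev_map[symmetric] sum_list.rev)
qed

lemma joining_path_rev:
  assumes "joining_path E x y p"
  shows "joining_path E y x (rev p)"
  using assms by (auto simp: joining_path_def hd_rev last_rev insert_commute)

lemma wdist_commute: "wdist E w x y = wdist E w y x"
proof -
  have "path_weight w ` {p. joining_path E x y p} \<subseteq> path_weight w ` {p. joining_path E y x p}" for x y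
    using joining_path_rev path_weight_rev by (smt (verit) image_subset_iff mem_Collect_eq image_eqI)
  then show ?thesis
    unfolding wdist_def by (metis subset_antisym)
qed

lemma length_joining_path_le:
  assumes "joining_path E x y p" "x \<in> V"
  shows "length (path_edges p) \<le> card V"
proof -
  have "length (path_edges p) \<le> length p"
    by (simp add: path_edges_def)
  also have "\<dots> = card (set p)"
    using assms(1) by (simp add: joining_path_def distinct_card)
  also have "\<dots> \<le> card V"
    using joining_path_in_V[OF assms] finite_V by (rule card_mono[rotated])
  finally show ?thesis .
qed

lemma joining_path_edges: "joining_path E x y p \<Longrightarrow> set (path_edges p) \<subseteq> E"
  by (simp add: joining_path_def path_edges_subset)

lemma wdist_attained:
  assumes "x \<in> V" "y \<in> V"
  obtains p where "joining_path E x y p" "wdist E w x y = path_weight w p"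
proof -
  have "wdist E w x y \<in> path_weight w ` {p. joining_path E x y p}"
    unfolding wdist_def using finite_joining_paths connected assms by (intro Min_in) auto
  then show ?thesis using that by blast
qed

lemma wdist_nonneg:
  assumes "\<forall>e\<in>E. 0 < w e" "x \<in> V" "y \<in> V"
  shows "0 \<le> wdist E w x y"
proof -
  obtain p where p: "joining_path E x y p" "wdist E w x y = path_weight w p"
    using wdist_attained[OF assms(2,3)] .
  show ?thesis
    unfolding p path_weight_eq using joining_path_edges[OF p(1)] assms(1)
    by (intro sum_list_nonneg) fastforce
qed

text \<open>
  A path between distinct vertices has at least one edge.
\<close>

lemma wdist_ge:
  assumes "\<forall>e\<in>E. a \<le> w e" "0 \<le> a" "x \<in> V" "y \<in> V" "x \<noteq> y"
  shows "a \<le> wdist E w x y"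
proof -
  obtain p where p: "joining_path E x y p" "wdist E w x y = path_weight w p"
    using wdist_attained[OF assms(3,4)] .
  obtain u v q where uv: "p = u # v # q"
    using p(1) assms(5) by (cases p rule: remdups_adj.cases) (auto simp: joining_path_def)
  have "0 \<le> sum_list (map w (path_edges (v # q)))"
    using joining_path_edges[OF p(1)] assms(1,2)
    by (intro sum_list_nonneg) (fastforce simp: uv)
  moreover have "a \<le> w {u, v}"
    using joining_path_edges[OF p(1)] assms(1) by (simp add: uv)
  ultimately show ?thesis
    by (simp add: p(2) path_weight_eq uv)
qed

lemma wdist_pos:
  assumes "\<forall>e\<in>E. 0 < w e" "{x, y} \<in> E"
  shows "0 < wdist E w x y"
proof -
  have "Min (w ` E) \<in> w ` E"
    using assms(2) finite_E by (intro Min_in) auto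
  then have "0 < Min (w ` E)"
    using assms(1) by auto
  also have "\<dots> \<le> wdist E w x y"
    using edge_ends[OF assms(2)] finite_E calculation by (intro wdist_ge) auto
  finally show ?thesis .
qed

text \<open>
  A path without repeated vertices has fewer than \<open>card V\<close> edges. The factor \<open>card V\<close> is generous, but
  only linearity in the total weight matters for the growth estimate.
\<close>

lemma wdist_le_total:
  fixes w :: "'a set \<Rightarrow> real"
  assumes "\<forall>e\<in>E. 0 < w e" "x \<in> V" "y \<in> V"
  shows "wdist E w x y \<le> card V * sum w E"
proof -
  obtain p where p: "joining_path E x y p" "wdist E w x y = path_weight w p"
    using wdist_attained[OF assms(2,3)] .
  have nonneg: "0 \<le> sum w E"
    using assms(1) by (simp add: less_imp_le sum_nonneg)
  have "sum_list (map w (path_edges p)) \<le> sum_list (map (\<lambda>_. sum w E) (path_edges p))"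
  proof (rule sum_list_mono)
    fix e assume "e \<in> set (path_edges p)"
    then show "w e \<le> sum w E"
      using joining_path_edges[OF p(1)] assms(1) finite_E
      by (intro member_le_sum) (auto intro: less_imp_le)
  qed
  also have "\<dots> = length (path_edges p) * sum w E"
    by (simp add: sum_list_triv)
  also have "\<dots> \<le> card V * sum w E"
    using length_joining_path_le[OF p(1) assms(2)] nonneg by (intro mult_right_mono) auto
  finally show ?thesis by (simp add: p(2) path_weight_eq)
qed

end

locale weighted_walk = finite_graph V E
  for V :: "'a set" and E :: "'a set set" +
  fixes \<gamma> :: "real \<Rightarrow> real"
  assumes gamma_pos: "0 < t \<Longrightarrow> 0 < \<gamma> t"
begin

lemma degree_pos:
  assumes "\<forall>e\<in>E. 0 < w e" "{x, y} \<in> E"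
  shows "0 < (\<Sum>z | {x, z} \<in> E. \<gamma> (w {x, z}))"
  using assms neighbours gamma_pos by (intro sum_pos) auto

text \<open>
  A vertex with a neighbour sends all of its mass \<open>1 - \<alpha>\<close> away. This is what forces couplings at
  large idleness to keep much mass at a single pair.
\<close>

lemma sum_walk_measure_off_diagonal:
  assumes "\<forall>e\<in>E. 0 < w e" "{x, y} \<in> E"
  shows "(\<Sum>z\<in>V - {x}. walk_measure \<gamma> E w \<alpha> x z) = 1 - \<alpha>"
proof -
  have "(\<Sum>z\<in>V - {x}. walk_measure \<gamma> E w \<alpha> x z) =
      (\<Sum>z | {x, z} \<in> E. walk_measure \<gamma> E w \<alpha> x z)"
    using neighbours finite_V by (intro sum.mono_neutral_right) (auto simp: walk_measure_def)
  also have "\<dots> = (\<Sum>z | {x, z} \<in> E.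
      (1 - \<alpha>) * (\<gamma> (w {x, z}) / (\<Sum>z | {x, z} \<in> E. \<gamma> (w {x, z}))))"
    using edge_ends(3) by (intro sum.cong) (auto simp: walk_measure_def)
  also have "\<dots> = 1 - \<alpha>"
    using degree_pos[OF assms] by (simp flip: sum_distrib_left sum_divide_distrib)
  finally show ?thesis .
qed

lemma prob_on_walk_measure:
  assumes "\<forall>e\<in>E. 0 < w e" "{x, y} \<in> E" "0 \<le> \<alpha>" "\<alpha> \<le> 1"
  shows "prob_on V (walk_measure \<gamma> E w \<alpha> x)"
  unfolding prob_on_def
proof
  have deg: "0 \<le> (\<Sum>z | {x, z} \<in> E. \<gamma> (w {x, z}))"
    using degree_pos[OF assms(1,2)] by simp
  show "\<forall>z\<in>V. 0 \<le> walk_measure \<gamma> E w \<alpha> x z"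
    using assms gamma_pos less_imp_le[OF gamma_pos] deg
    by (auto simp: walk_measure_def intro!: mult_nonneg_nonneg divide_nonneg_nonneg)
  show "sum (walk_measure \<gamma> E w \<alpha> x) V = 1"
    using sum_walk_measure_off_diagonal[OF assms(1,2)] edge_ends(1)[OF assms(2)] finite_V
    by (subst sum.remove[of V x]) (auto simp: walk_measure_def)
qed

definition lazy_cost :: "('a set \<Rightarrow> real) \<Rightarrow> 'a \<Rightarrow> 'a \<Rightarrow> real" where
  "lazy_cost w x y =
     wasserstein V E w (walk_measure \<gamma> E w (1 / 2) x) (walk_measure \<gamma> E w (1 / 2) y)"

lemma walk_measure_half:
  "walk_measure \<gamma> E w \<alpha> x z =
     2 * (1 - \<alpha>) * walk_measure \<gamma> E w (1 / 2) x z + (if z = x then 2 * \<alpha> - 1 else 0)"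
  by (auto simp: walk_measure_def algebra_simps diff_divide_distrib)

text \<open>
  Adding the point mass \<open>2 \<alpha> - 1\<close> at \<open>(x, y)\<close> turns a rescaled coupling at idleness \<open>1/2\<close> into one at
  idleness \<open>\<alpha>\<close>. Conversely every coupling at idleness \<open>\<alpha>\<close> puts mass at least \<open>2 \<alpha> - 1\<close> on
  \<open>(x, y)\<close>: row \<open>x\<close> carries mass \<open>\<alpha>\<close>, and only \<open>1 - \<alpha>\<close> of it fits into the columns other than \<open>y\<close>. So
  the point mass can be removed again, and the two optimal costs determine each other.
\<close>

lemma wasserstein_affine_in_idleness:
  fixes w :: "'a set \<Rightarrow> real"
  assumes w: "\<forall>e\<in>E. 0 < w e" and xy: "{x, y} \<in> E" and \<alpha>: "1 / 2 \<le> \<alpha>" "\<alpha> < 1"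
  shows "wasserstein V E w (walk_measure \<gamma> E w \<alpha> x) (walk_measure \<gamma> E w \<alpha> y) =
    2 * (1 - \<alpha>) * lazy_cost w x y + (2 * \<alpha> - 1) * wdist E w x y"
proof -
  note V = edge_ends[OF xy]
  define \<delta> :: "'a \<Rightarrow> 'a \<Rightarrow> real" where "\<delta> u v = (if u = x then if v = y then 1 else 0 else 0)" for u v
  define p where "p \<alpha> = walk_measure \<gamma> E w \<alpha> x" for \<alpha>
  define q where "q \<alpha> = walk_measure \<gamma> E w \<alpha> y" for \<alpha>
  have yx: "{y, x} \<in> E"
    using xy by (simp add: insert_commute)
  have p: "prob_on V (p \<alpha>)" and q: "prob_on V (q \<alpha>)" if "1 / 2 \<le> \<alpha>" "\<alpha> < 1" for \<alpha>
    unfolding p_def q_def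
    using prob_on_walk_measure[OF w xy] prob_on_walk_measure[OF w yx] that by auto
  have d_nonneg: "\<lbrakk>u \<in> V; v \<in> V\<rbrakk> \<Longrightarrow> 0 \<le> wdist E w u v" for u v
    using wdist_nonneg[OF w] .
  have \<delta>_nonneg: "0 \<le> \<delta> u v" for u v
    by (simp add: \<delta>_def)
  have \<delta>_row: "(\<Sum>v\<in>V. \<delta> u v) = (if u = x then 1 else 0)" for u
    using V finite_V by (simp add: \<delta>_def)
  have \<delta>_col: "(\<Sum>u\<in>V. \<delta> u v) = (if v = y then 1 else 0)" for v
    using V finite_V by (simp add: \<delta>_def)
  have \<delta>_cost: "transport_cost V (wdist E w) \<delta> = wdist E w x y"
  proof -
    have "\<delta> u v * wdist E w u v = (if v = y then if u = x then wdist E w x y else 0 else 0)" for u v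
      by (simp add: \<delta>_def)
    then show ?thesis
      using V finite_V by (simp add: transport_cost_def)
  qed
  have cost_linear: "transport_cost V c (\<lambda>u v. r * A u v + s * B u v) =
      r * transport_cost V c A + s * transport_cost V c B" for c r s and A B :: "'a \<Rightarrow> 'a \<Rightarrow> real"
    by (simp add: transport_cost_def sum.distrib sum_distrib_left distrib_right mult.assoc)
  have half: "1 / 2 \<le> (1 / 2 :: real)" "(1 / 2 :: real) < 1" by auto
  let ?W = "\<lambda>\<alpha>. optimal_cost V (wdist E w) (p \<alpha>) (q \<alpha>)"
  have p_half: "p \<alpha> u = 2 * (1 - \<alpha>) * p (1 / 2) u + (2 * \<alpha> - 1) * (if u = x then 1 else 0)" for u
    using walk_measure_half[of w \<alpha> x u] by (simp add: p_def)
  have q_half: "q \<alpha> v = 2 * (1 - \<alpha>) * q (1 / 2) v + (2 * \<alpha> - 1) * (if v = y then 1 else 0)" for v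
    using walk_measure_half[of w \<alpha> y v] by (simp add: q_def)
  have "(?W \<alpha> - (2 * \<alpha> - 1) * wdist E w x y) / (2 * (1 - \<alpha>)) \<le> ?W (1 / 2)"
  proof (rule optimal_cost_greatest[OF p[OF half] q[OF half]])
    fix A assume A: "coupling V (p (1 / 2)) (q (1 / 2)) A"
    let ?A = "\<lambda>u v. 2 * (1 - \<alpha>) * A u v + (2 * \<alpha> - 1) * \<delta> u v"
    have "coupling V (p \<alpha>) (q \<alpha>) ?A"
      using A \<alpha> unfolding coupling_def p_half q_half
      by (simp add: sum.distrib \<delta>_row \<delta>_col \<delta>_nonneg flip: sum_distrib_left)
    then have "?W \<alpha> \<le> transport_cost V (wdist E w) ?A"
      using d_nonneg by (rule optimal_cost_le)
    then show "(?W \<alpha> - (2 * \<alpha> - 1) * wdist E w x y) / (2 * (1 - \<alpha>)) \<le> transport_cost V (wdist E w) A"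
      unfolding cost_linear \<delta>_cost using \<alpha> by (simp add: field_simps)
  qed
  moreover have "2 * (1 - \<alpha>) * ?W (1 / 2) + (2 * \<alpha> - 1) * wdist E w x y \<le> ?W \<alpha>"
  proof (rule optimal_cost_greatest[OF p[OF \<alpha>] q[OF \<alpha>]])
    fix A assume A: "coupling V (p \<alpha>) (q \<alpha>) A"
    let ?r = "1 / (2 * (1 - \<alpha>))" and ?s = "- ((2 * \<alpha> - 1) / (2 * (1 - \<alpha>)))"
    let ?A = "\<lambda>u v. ?r * A u v + ?s * \<delta> u v"
    have pos: "\<lbrakk>u \<in> V; v \<in> V\<rbrakk> \<Longrightarrow> 0 \<le> A u v" for u v
      using A by (simp add: coupling_def)
    have combine: "1 / d * a + - (c / d) * e = (a - c * e) / d" for a c d e :: real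
      by (simp add: diff_divide_distrib)
    have sum_linear: "(\<Sum>v\<in>V. a * f v + b * g v) = a * sum f V + b * sum g V"
      for a b and f g :: "'a \<Rightarrow> real"
      by (simp add: sum.distrib sum_distrib_left)
    have rescale: "?r * (2 * (1 - \<alpha>) * m + (2 * \<alpha> - 1) * e) + ?s * e = m" for m e
      using \<alpha> by (simp add: divide_simps)
    have "2 * \<alpha> - 1 \<le> A x y"
    proof -
      have "\<alpha> = (\<Sum>v\<in>V. A x v)"
        using A V by (simp add: coupling_def p_def walk_measure_def)
      also have "\<dots> = A x y + (\<Sum>v\<in>V - {y}. A x v)"
        using V(2) finite_V by (intro sum.remove)
      also have "(\<Sum>v\<in>V - {y}. A x v) \<le> (\<Sum>v\<in>V - {y}. \<Sum>u\<in>V. A u v)"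
        using V finite_V pos by (intro sum_mono member_le_sum) auto
      also have "\<dots> = (\<Sum>v\<in>V - {y}. q \<alpha> v)"
        using A by (intro sum.cong) (auto simp: coupling_def)
      also have "\<dots> = 1 - \<alpha>"
        unfolding q_def by (rule sum_walk_measure_off_diagonal[OF w yx])
      finally show ?thesis by simp
    qed
    then have "0 \<le> A u v - (2 * \<alpha> - 1) * \<delta> u v" if "u \<in> V" "v \<in> V" for u v
      using pos[OF that] by (auto simp: \<delta>_def)
    then have "0 \<le> (A u v - (2 * \<alpha> - 1) * \<delta> u v) / (2 * (1 - \<alpha>))" if "u \<in> V" "v \<in> V" for u v
      using that \<alpha> by (intro divide_nonneg_nonneg) auto
    then have "0 \<le> ?A u v" if "u \<in> V" "v \<in> V" for u v
      using that unfolding combine .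
    moreover have "(\<Sum>v\<in>V. ?A u v) = p (1 / 2) u" if "u \<in> V" for u
    proof -
      have "(\<Sum>v\<in>V. ?A u v) = ?r * p \<alpha> u + ?s * (if u = x then 1 else 0)"
        using A that unfolding sum_linear \<delta>_row by (simp add: coupling_def)
      then show ?thesis
        using rescale[of "p (1 / 2) u"] by (simp only: p_half[of u])
    qed
    moreover have "(\<Sum>u\<in>V. ?A u v) = q (1 / 2) v" if "v \<in> V" for v
    proof -
      have "(\<Sum>u\<in>V. ?A u v) = ?r * q \<alpha> v + ?s * (if v = y then 1 else 0)"
        using A that unfolding sum_linear \<delta>_col by (simp add: coupling_def)
      then show ?thesis
        using rescale[of "q (1 / 2) v"] by (simp only: q_half[of v])
    qed
    ultimately have "coupling V (p (1 / 2)) (q (1 / 2)) ?A"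
      by (simp only: coupling_def) blast
    then have "?W (1 / 2) \<le> transport_cost V (wdist E w) ?A"
      using d_nonneg by (rule optimal_cost_le)
    then have "?W (1 / 2) * (2 * (1 - \<alpha>)) \<le> transport_cost V (wdist E w) A - (2 * \<alpha> - 1) * wdist E w x y"
      unfolding cost_linear[of _ ?r A ?s \<delta>] \<delta>_cost unfolding combine using \<alpha> by (subst (asm) pos_le_divide_eq) auto
    then show "2 * (1 - \<alpha>) * ?W (1 / 2) + (2 * \<alpha> - 1) * wdist E w x y \<le> transport_cost V (wdist E w) A"
      by (simp add: mult.commute)
  qed
  ultimately have "?W \<alpha> = 2 * (1 - \<alpha>) * ?W (1 / 2) + (2 * \<alpha> - 1) * wdist E w x y"
    using \<alpha> by (simp add: field_simps)
  then show ?thesis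
    by (simp add: lazy_cost_def wasserstein_eq_optimal_cost p_def q_def)
qed

lemma olly_curvature_eq:
  fixes w :: "'a set \<Rightarrow> real"
  assumes w: "\<forall>e\<in>E. 0 < w e" and xy: "{x, y} \<in> E"
  shows "olly_curvature \<gamma> V E w x y = 2 * (1 - lazy_cost w x y / wdist E w x y)"
proof -
  let ?k = "2 * (1 - lazy_cost w x y / wdist E w x y)"
  have d: "0 < wdist E w x y"
    using wdist_pos[OF w xy] .
  have "alpha_curvature \<gamma> V E w \<alpha> x y / (1 - \<alpha>) = ?k" if "1 / 2 < \<alpha>" "\<alpha> < 1" for \<alpha>
    using that d unfolding alpha_curvature_def
    by (subst wasserstein_affine_in_idleness[OF w xy]) (auto simp: field_simps)
  then have "\<forall>\<^sub>F \<alpha> in at_left 1. alpha_curvature \<gamma> V E w \<alpha> x y / (1 - \<alpha>) = ?k"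
    by (auto simp: eventually_at_left_field intro!: exI[of _ "1 / 2"])
  then have "((\<lambda>\<alpha>. alpha_curvature \<gamma> V E w \<alpha> x y / (1 - \<alpha>)) \<longlongrightarrow> ?k) (at_left 1)"
    by (rule tendsto_eventually)
  then show ?thesis
    unfolding olly_curvature_def by (intro tendsto_Lim) auto
qed

text \<open>
  The lower bound yields \<open>\<kappa> \<le> 2\<close>, which keeps the weights positive; the upper bound, linear in the total
  weight, keeps them from blowing up in finite time.
\<close>

lemma lazy_cost_bounds:
  fixes w :: "'a set \<Rightarrow> real"
  assumes w: "\<forall>e\<in>E. 0 < w e" and xy: "{x, y} \<in> E"
  shows "0 \<le> lazy_cost w x y" "lazy_cost w x y \<le> card V * sum w E"
proof -
  let ?p = "walk_measure \<gamma> E w (1 / 2) x" and ?q = "walk_measure \<gamma> E w (1 / 2) y"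
  have p: "prob_on V ?p" "prob_on V ?q"
    using prob_on_walk_measure[OF w, of x y "1 / 2"] prob_on_walk_measure[OF w, of y x "1 / 2"] xy
    by (auto simp: insert_commute)
  have d: "\<lbrakk>u \<in> V; v \<in> V\<rbrakk> \<Longrightarrow> 0 \<le> wdist E w u v" for u v
    using wdist_nonneg[OF w] .
  show "0 \<le> lazy_cost w x y"
    unfolding lazy_cost_def wasserstein_eq_optimal_cost
    using d by (intro optimal_cost_greatest[OF p]) (rule transport_cost_nonneg)
  have "lazy_cost w x y \<le> transport_cost V (wdist E w) (\<lambda>u v. ?p u * ?q v)"
    unfolding lazy_cost_def wasserstein_eq_optimal_cost
    using product_coupling[OF p] d by (rule optimal_cost_le)
  also have "\<dots> \<le> card V * sum w E"
    using p(1) product_coupling[OF p] wdist_le_total[OF w] by (rule transport_cost_le)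
  finally show "lazy_cost w x y \<le> card V * sum w E" .
qed

text \<open>
  The flow has one unknown for each unordered edge, while the curvature takes an ordered pair; symmetry
  makes the right-hand side of the equation a function of the edge.
\<close>

lemma olly_curvature_commute:
  fixes w :: "'a set \<Rightarrow> real"
  assumes w: "\<forall>e\<in>E. 0 < w e" and xy: "{x, y} \<in> E"
  shows "olly_curvature \<gamma> V E w x y = olly_curvature \<gamma> V E w y x"
proof -
  have yx: "{y, x} \<in> E"
    using xy by (simp add: insert_commute)
  have "lazy_cost w x y = lazy_cost w y x"
    unfolding lazy_cost_def wasserstein_eq_optimal_cost
    using prob_on_walk_measure[OF w xy, of "1 / 2"] prob_on_walk_measure[OF w yx, of "1 / 2"]
      wdist_commute wdist_nonneg[OF w]
    by (intro optimal_cost_commute) auto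
  then show ?thesis
    using olly_curvature_eq[OF w xy] olly_curvature_eq[OF w yx] wdist_commute[of w x y] by simp
qed

end

section \<open>Ordinary differential equations with a Lipschitz field\<close>

lemma le_of_nonneg_derivative_within:
  fixes f :: "real \<Rightarrow> real"
  assumes "0 \<le> T"
    and "\<And>t. t \<in> {0..T} \<Longrightarrow> (f has_real_derivative f' t) (at t within {0..T})"
    and "\<And>t. t \<in> {0..T} \<Longrightarrow> 0 \<le> f' t"
  shows "f 0 \<le> f T"
proof (cases "T = 0")
  case False
  then have "\<exists>t\<in>{0<..<T}. f T - f 0 = f' t * (T - 0)"
    using assms by (intro mvt_simple) (auto simp: has_field_derivative_def)
  then obtain t where "t \<in> {0<..<T}" "f T - f 0 = f' t * T"
    by auto
  moreover from this have "0 \<le> f' t * T"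
    using assms(1,3) by (intro mult_nonneg_nonneg) auto
  ultimately show ?thesis by simp
qed simp

lemma gronwall_nonneg_growth:
  fixes g :: "real \<Rightarrow> real"
  assumes "0 \<le> T"
    and deriv: "\<And>t. t \<in> {0..T} \<Longrightarrow> (g has_real_derivative g' t) (at t within {0..T})"
    and growth: "\<And>t. t \<in> {0..T} \<Longrightarrow> g' t \<le> c * g t"
  shows "g T \<le> g 0 * exp (c * T)"
proof -
  let ?h = "\<lambda>t. - (g t * exp (- c * t))"
  have "?h 0 \<le> ?h T"
  proof (rule le_of_nonneg_derivative_within[OF assms(1)])
    fix t assume t: "t \<in> {0..T}"
    show "(?h has_real_derivative (c * g t - g' t) * exp (- c * t)) (at t within {0..T})"
      by (rule derivative_eq_intros deriv[OF t] refl)+ (simp add: algebra_simps)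
    show "0 \<le> (c * g t - g' t) * exp (- c * t)"
      using growth[OF t] by simp
  qed
  then have "g T * exp (- c * T) \<le> g 0" by simp
  then have "g T * exp (- c * T) * exp (c * T) \<le> g 0 * exp (c * T)"
    by (rule mult_right_mono) simp
  then show ?thesis by (simp flip: exp_add add: mult.assoc)
qed

text \<open>
  The squared distance \<open>q\<close> of two solutions satisfies \<open>q' \<le> c q\<close> and \<open>q(0) = 0\<close>. Only a Lipschitz
  bound on a set \<open>B\<close> that contains both trajectories enters, so the lemma applies to a field that is
  merely locally Lipschitz.
\<close>

lemma ode_solution_unique:
  fixes F :: "'i \<Rightarrow> ('i \<Rightarrow> real) \<Rightarrow> real" and X Y :: "real \<Rightarrow> 'i \<Rightarrow> real"
  assumes "finite I" "0 \<le> T"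
    and lip: "\<And>i u v. \<lbrakk>i \<in> I; u \<in> B; v \<in> B\<rbrakk> \<Longrightarrow> \<bar>F i u - F i v\<bar> \<le> L * (\<Sum>j\<in>I. \<bar>u j - v j\<bar>)"
    and B: "\<And>t. t \<in> {0..T} \<Longrightarrow> X t \<in> B \<and> Y t \<in> B"
    and init: "\<And>i. i \<in> I \<Longrightarrow> X 0 i = Y 0 i"
    and X: "\<And>i t. \<lbrakk>i \<in> I; t \<in> {0..T}\<rbrakk> \<Longrightarrow>
      ((\<lambda>s. X s i) has_real_derivative F i (X t)) (at t within {0..T})"
    and Y: "\<And>i t. \<lbrakk>i \<in> I; t \<in> {0..T}\<rbrakk> \<Longrightarrow>
      ((\<lambda>s. Y s i) has_real_derivative F i (Y t)) (at t within {0..T})"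
    and "i \<in> I"
  shows "X T i = Y T i"
proof -
  define z where "z t i = X t i - Y t i" for t i
  define q where "q t = (\<Sum>i\<in>I. (z t i)\<^sup>2)" for t
  define q' where "q' t = (\<Sum>i\<in>I. 2 * z t i * (F i (X t) - F i (Y t)))" for t
  have "q T \<le> q 0 * exp (2 * \<bar>L\<bar> * card I * T)"
  proof (rule gronwall_nonneg_growth[OF assms(2)])
    fix t assume t: "t \<in> {0..T}"
    show "(q has_real_derivative q' t) (at t within {0..T})"
      unfolding q_def q'_def z_def
      by (rule derivative_eq_intros X Y t refl | assumption)+ (simp add: algebra_simps)
    have "q' t \<le> (\<Sum>i\<in>I. 2 * \<bar>z t i\<bar> * (\<bar>L\<bar> * (\<Sum>j\<in>I. \<bar>z t j\<bar>)))"
      unfolding q'_def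
    proof (rule sum_mono)
      fix i assume i: "i \<in> I"
      have "\<bar>F i (X t) - F i (Y t)\<bar> \<le> L * (\<Sum>j\<in>I. \<bar>z t j\<bar>)"
        using lip[OF i] B[OF t] by (simp add: z_def)
      also have "\<dots> \<le> \<bar>L\<bar> * (\<Sum>j\<in>I. \<bar>z t j\<bar>)"
        by (intro mult_right_mono) (auto intro: sum_nonneg)
      finally have "\<bar>z t i\<bar> * \<bar>F i (X t) - F i (Y t)\<bar> \<le> \<bar>z t i\<bar> * (\<bar>L\<bar> * (\<Sum>j\<in>I. \<bar>z t j\<bar>))"
        by (rule mult_left_mono) simp
      moreover have "z t i * (F i (X t) - F i (Y t)) \<le> \<bar>z t i\<bar> * \<bar>F i (X t) - F i (Y t)\<bar>"
        by (metis abs_ge_self abs_mult)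
      ultimately show "2 * z t i * (F i (X t) - F i (Y t))
          \<le> 2 * \<bar>z t i\<bar> * (\<bar>L\<bar> * (\<Sum>j\<in>I. \<bar>z t j\<bar>))"
        by linarith
    qed
    also have "\<dots> = 2 * \<bar>L\<bar> * (\<Sum>i\<in>I. \<bar>z t i\<bar>)\<^sup>2"
      by (simp add: power2_eq_square sum_distrib_left sum_distrib_right algebra_simps)
    also have "\<dots> \<le> 2 * \<bar>L\<bar> * ((\<Sum>i\<in>I. \<bar>z t i\<bar>\<^sup>2) * card I)"
      by (intro mult_left_mono sum_squared_le_sum_of_squares) simp
    also have "\<dots> = 2 * \<bar>L\<bar> * card I * q t"
      by (simp add: q_def)
    finally show "q' t \<le> 2 * \<bar>L\<bar> * card I * q t" .
  qed
  moreover have "q 0 = 0"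
    using init by (simp add: q_def z_def)
  ultimately have "q T \<le> 0" by simp
  then have "q T = 0"
    by (simp add: q_def antisym sum_nonneg)
  then have "(z T i)\<^sup>2 = 0"
    using assms(1) \<open>i \<in> I\<close> by (simp add: q_def sum_nonneg_eq_0_iff)
  then show ?thesis by (simp add: z_def)
qed

primrec picard_iterate ::
  "('i \<Rightarrow> ('i \<Rightarrow> real) \<Rightarrow> real) \<Rightarrow> ('i \<Rightarrow> real) \<Rightarrow> nat \<Rightarrow> real \<Rightarrow> 'i \<Rightarrow> real" where
  "picard_iterate F x\<^sub>0 0 t i = x\<^sub>0 i"
| "picard_iterate F x\<^sub>0 (Suc n) t i = x\<^sub>0 i + integral {0..t} (\<lambda>s. F i (picard_iterate F x\<^sub>0 n s))"

text \<open>
  The unknowns are indexed by a finite set rather than a type, so the iteration is carried out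
  coordinate by coordinate. With the weight \<open>exp (2 K t)\<close>, where
  \<open>K\<close> exceeds the Lipschitz constant in the sum norm, each step at least halves the distance of
  successive iterates. They converge uniformly on the whole of \<open>[0, T]\<close>, however large \<open>T\<close> is.
\<close>

lemma picard_existence:
  fixes F :: "'i \<Rightarrow> ('i \<Rightarrow> real) \<Rightarrow> real" and x\<^sub>0 :: "'i \<Rightarrow> real"
  assumes "finite I" "0 \<le> T" "0 \<le> L"
    and lip: "\<And>i u v. i \<in> I \<Longrightarrow> \<bar>F i u - F i v\<bar> \<le> L * (\<Sum>j\<in>I. \<bar>u j - v j\<bar>)"
  obtains X where "\<forall>i\<in>I. X 0 i = x\<^sub>0 i"
    and "\<forall>i\<in>I. \<forall>t\<in>{0..T}.
      ((\<lambda>s. X s i) has_real_derivative F i (X t)) (at t within {0..T})"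
proof -
  have F_cont: "continuous_on S (\<lambda>s. F i (Y s))"
    if "i \<in> I" "\<And>j. j \<in> I \<Longrightarrow> continuous_on S (\<lambda>s. Y s j)" for S :: "real set" and Y i
    unfolding continuous_on_def
  proof
    fix t assume t: "t \<in> S"
    have "((\<lambda>s. L * (\<Sum>j\<in>I. \<bar>Y s j - Y t j\<bar>)) \<longlongrightarrow> L * (\<Sum>j\<in>I. \<bar>Y t j - Y t j\<bar>)) (at t within S)"
      using that(2) t unfolding continuous_on_def by (intro tendsto_intros) auto
    then have null: "((\<lambda>s. L * (\<Sum>j\<in>I. \<bar>Y s j - Y t j\<bar>)) \<longlongrightarrow> 0) (at t within S)"
      by simp
    have "((\<lambda>s. F i (Y s) - F i (Y t)) \<longlongrightarrow> 0) (at t within S)"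
    proof (rule Lim_null_comparison[OF _ null])
      show "\<forall>\<^sub>F s in at t within S. norm (F i (Y s) - F i (Y t)) \<le> L * (\<Sum>j\<in>I. \<bar>Y s j - Y t j\<bar>)"
        using lip[OF that(1)] by simp
    qed
    then show "((\<lambda>s. F i (Y s)) \<longlongrightarrow> F i (Y t)) (at t within S)"
      by (simp add: LIM_zero_iff)
  qed
  define P where "P = picard_iterate F x\<^sub>0"
  have P0: "P 0 t i = x\<^sub>0 i" and PS: "P (Suc n) t i = x\<^sub>0 i + integral {0..t} (\<lambda>s. F i (P n s))" for n t i
    by (simp_all add: P_def)
  have P_cont: "continuous_on {0..T} (\<lambda>s. P n s i)" if "i \<in> I" for n i
    using that
  proof (induction n arbitrary: i)
    case (Suc n)
    have "continuous_on {0..T} (\<lambda>s. F i (P n s))"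
      using Suc by (intro F_cont) auto
    then show ?case
      unfolding PS by (intro continuous_intros indefinite_integral_continuous_1 integrable_continuous_real)
  qed (simp add: P0)
  have FP_cont: "continuous_on {0..t} (\<lambda>s. F i (P n s))" if "i \<in> I" "t \<le> T" for n i t
    using that by (intro F_cont continuous_on_subset[OF P_cont]) auto
  \<comment> \<open>The summand \<open>1\<close> makes \<open>K\<close> positive, as the integral of \<open>exp (2 K s)\<close> is divided by \<open>2 K\<close>.\<close>
  define K where "K = card I * L + 1"
  have K: "0 < K" "card I * L \<le> K"
    using assms(3) by (auto simp: K_def add_nonneg_pos)
  define C where "C = (\<Sum>i\<in>I. T * \<bar>F i x\<^sub>0\<bar>)"
  have C: "0 \<le> C"
    unfolding C_def using assms(2) by (intro sum_nonneg) auto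
  have step: "(\<Sum>i\<in>I. \<bar>P (Suc n) t i - P n t i\<bar>) \<le> C / 2 ^ n * exp (2 * K * t)" if "t \<in> {0..T}" for n t
    using that
  proof (induction n arbitrary: t)
    case 0
    have "P 0 s = x\<^sub>0" for s
      by (rule ext) (rule P0)
    then have "(\<Sum>i\<in>I. \<bar>P (Suc 0) t i - P 0 t i\<bar>) = (\<Sum>i\<in>I. t * \<bar>F i x\<^sub>0\<bar>)"
      using 0 by (simp add: PS abs_mult)
    also have "\<dots> \<le> C * 1"
      unfolding C_def using 0 by (auto intro!: sum_mono mult_right_mono)
    also have "\<dots> \<le> C * exp (2 * K * t)"
      using 0 C K by (intro mult_left_mono) auto
    finally show ?case by simp
  next
    case (Suc n)
    let ?e = "\<lambda>s. L * (C / 2 ^ n * exp (2 * K * s))"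
    have e: "(?e has_integral L * (C / 2 ^ n) * ((exp (2 * K * t) - 1) / (2 * K))) {0..t}"
    proof -
      let ?G = "\<lambda>s. L * (C / 2 ^ n) * (exp (2 * K * s) / (2 * K))"
      have "(?G has_real_derivative ?e s) (at s within {0..t})" for s
        using K(1) by (auto intro!: derivative_eq_intros)
      then have "(?e has_integral ?G t - ?G 0) {0..t}"
        using Suc.prems by (intro fundamental_theorem_of_calculus)
          (auto simp: has_real_derivative_iff_has_vector_derivative[symmetric])
      then show ?thesis by (simp add: diff_divide_distrib right_diff_distrib)
    qed
    have "\<bar>P (Suc (Suc n)) t i - P (Suc n) t i\<bar> \<le>
        L * (C / 2 ^ n) * ((exp (2 * K * t) - 1) / (2 * K))" if i: "i \<in> I" for i
    proof -
      have int: "(\<lambda>s. F i (P m s)) integrable_on {0..t}" for m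
        using FP_cont[OF i] Suc.prems by (intro integrable_continuous_real) auto
      have "P (Suc (Suc n)) t i - P (Suc n) t i =
          integral {0..t} (\<lambda>s. F i (P (Suc n) s) - F i (P n s))"
        using PS[of "Suc n" t i] PS[of n t i] integral_diff[OF int[of "Suc n"] int[of n]] by linarith
      moreover have "norm (integral {0..t} (\<lambda>s. F i (P (Suc n) s) - F i (P n s))) \<le> integral {0..t} ?e"
      proof (rule integral_norm_bound_integral)
        show "(\<lambda>s. F i (P (Suc n) s) - F i (P n s)) integrable_on {0..t}"
          by (intro integrable_diff int)
        show "?e integrable_on {0..t}"
          using e by blast
        fix s assume "s \<in> {0..t}"
        then have "(\<Sum>j\<in>I. \<bar>P (Suc n) s j - P n s j\<bar>) \<le> C / 2 ^ n * exp (2 * K * s)"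
          using Suc.prems by (intro Suc.IH) auto
        then have "L * (\<Sum>j\<in>I. \<bar>P (Suc n) s j - P n s j\<bar>) \<le> ?e s"
          using assms(3) by (rule mult_left_mono)
        then show "norm (F i (P (Suc n) s) - F i (P n s)) \<le> ?e s"
          using lip[OF i, of "P (Suc n) s" "P n s"] by simp
      qed
      ultimately show ?thesis
        using integral_unique[OF e] by simp
    qed
    then have "(\<Sum>i\<in>I. \<bar>P (Suc (Suc n)) t i - P (Suc n) t i\<bar>) \<le>
        (\<Sum>i\<in>I. L * (C / 2 ^ n) * ((exp (2 * K * t) - 1) / (2 * K)))"
      by (rule sum_mono)
    also have "\<dots> = (card I * L) * (C / 2 ^ n * ((exp (2 * K * t) - 1) / (2 * K)))"
      by simp
    also have "\<dots> \<le> K * (C / 2 ^ n * ((exp (2 * K * t) - 1) / (2 * K)))"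
      using K C Suc.prems by (intro mult_right_mono) auto
    also have "\<dots> = C / 2 ^ Suc n * (exp (2 * K * t) - 1)"
      using K by simp
    also have "\<dots> \<le> C / 2 ^ Suc n * exp (2 * K * t)"
      using C by (intro mult_left_mono) auto
    finally show ?case .
  qed
  define X where "X t i = x\<^sub>0 i + (\<Sum>n. P (Suc n) t i - P n t i)" for t i
  have limit: "uniform_limit {0..T} (\<lambda>n t. P n t i) (\<lambda>t. X t i) sequentially" if i: "i \<in> I" for i
  proof -
    have "uniform_limit {0..T} (\<lambda>n t. \<Sum>k<n. P (Suc k) t i - P k t i)
        (\<lambda>t. \<Sum>n. P (Suc n) t i - P n t i) sequentially"
    proof (rule Weierstrass_m_test)
      fix n t assume t: "t \<in> {0..T}"
      have "\<bar>P (Suc n) t i - P n t i\<bar> \<le> (\<Sum>i\<in>I. \<bar>P (Suc n) t i - P n t i\<bar>)"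
        using i assms(1) by (intro member_le_sum) auto
      also have "\<dots> \<le> C / 2 ^ n * exp (2 * K * t)"
        using t by (rule step)
      also have "\<dots> \<le> C / 2 ^ n * exp (2 * K * T)"
        using t C K by (intro mult_left_mono) auto
      finally show "norm (P (Suc n) t i - P n t i) \<le> C * exp (2 * K * T) * (1 / 2) ^ n"
        by (simp add: power_divide)
    qed (intro summable_mult summable_geometric, simp)
    then have "uniform_limit {0..T} (\<lambda>n t. x\<^sub>0 i + (P n t i - P 0 t i)) (\<lambda>t. X t i) sequentially"
      unfolding X_def sum_lessThan_telescope[of "\<lambda>n. P n _ i"]
      by (rule uniform_limit_add[OF uniform_limit_const])
    then show ?thesis by (simp add: P0)
  qed
  have X_cont: "continuous_on {0..T} (\<lambda>t. X t i)" if "i \<in> I" for i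
    by (rule uniform_limit_theorem[OF _ limit[OF that]]) (use P_cont that in auto)
  have FX_cont: "continuous_on {0..T} (\<lambda>s. F i (X s))" if "i \<in> I" for i
    using X_cont that by (intro F_cont)
  have F_limit: "uniform_limit {0..T} (\<lambda>n s. F i (P n s)) (\<lambda>s. F i (X s)) sequentially" if i: "i \<in> I" for i
  proof (rule uniform_limitI)
    fix \<epsilon> :: real assume \<epsilon>: "0 < \<epsilon>"
    define \<eta> where "\<eta> = \<epsilon> / K"
    have \<eta>: "0 < \<eta>"
      using \<epsilon> K by (simp add: \<eta>_def)
    have "\<forall>\<^sub>F n in sequentially. \<forall>j\<in>I. \<forall>s\<in>{0..T}. dist (P n s j) (X s j) < \<eta>"
      using uniform_limitD[OF limit \<eta>] assms(1) by (intro eventually_ball_finite) auto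
    then show "\<forall>\<^sub>F n in sequentially. \<forall>s\<in>{0..T}. dist (F i (P n s)) (F i (X s)) < \<epsilon>"
    proof eventually_elim
      case (elim n)
      show ?case
      proof
        fix s assume s: "s \<in> {0..T}"
        have "(\<Sum>j\<in>I. \<bar>P n s j - X s j\<bar>) \<le> (\<Sum>j\<in>I. \<eta>)"
          using elim s by (intro sum_mono) (auto simp: dist_real_def less_imp_le)
        then have "L * (\<Sum>j\<in>I. \<bar>P n s j - X s j\<bar>) \<le> L * (card I * \<eta>)"
          using assms(3) by (intro mult_left_mono) auto
        also have "\<dots> < K * \<eta>"
          using \<eta> by (simp add: K_def algebra_simps)
        also have "\<dots> = \<epsilon>"
          using K by (simp add: \<eta>_def)
        finally show "dist (F i (P n s)) (F i (X s)) < \<epsilon>"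
          using lip[OF i, of "P n s" "X s"] by (simp add: dist_real_def)
      qed
    qed
  qed
  have integral_eq: "X t i = x\<^sub>0 i + integral {0..t} (\<lambda>s. F i (X s))" if i: "i \<in> I" and t: "t \<in> {0..T}" for i t
  proof -
    have "uniform_limit {0..t} (\<lambda>n s. F i (P n s)) (\<lambda>s. F i (X s)) sequentially"
      using F_limit[OF i] by (rule uniform_limit_on_subset) (use t in auto)
    then obtain J l where J: "\<And>n. ((\<lambda>s. F i (P n s)) has_integral J n) {0..t}"
        "((\<lambda>s. F i (X s)) has_integral l) {0..t}" "J \<longlonglongrightarrow> l"
      by (rule uniform_limit_integral) (use FP_cont[OF i] t in auto)
    have "(\<lambda>n. integral {0..t} (\<lambda>s. F i (P n s))) \<longlonglongrightarrow> integral {0..t} (\<lambda>s. F i (X s))"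
      using J(3) integral_unique[OF J(1)] integral_unique[OF J(2)] by simp
    then have "(\<lambda>n. P (Suc n) t i) \<longlonglongrightarrow> x\<^sub>0 i + integral {0..t} (\<lambda>s. F i (X s))"
      unfolding PS by (intro tendsto_intros)
    moreover have "(\<lambda>n. P (Suc n) t i) \<longlonglongrightarrow> X t i"
      using tendsto_uniform_limitI[OF limit[OF i] t] by (rule LIMSEQ_Suc)
    ultimately show ?thesis
      using LIMSEQ_unique by blast
  qed
  show thesis
  proof
    show "\<forall>i\<in>I. X 0 i = x\<^sub>0 i"
      using integral_eq[of _ 0] assms(2) by simp
    show "\<forall>i\<in>I. \<forall>t\<in>{0..T}. ((\<lambda>s. X s i) has_real_derivative F i (X t)) (at t within {0..T})"
    proof (intro ballI)
      fix i t assume i: "i \<in> I" and t: "t \<in> {0..T}"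
      have "((\<lambda>s. x\<^sub>0 i + integral {0..s} (\<lambda>s. F i (X s))) has_real_derivative F i (X t))
          (at t within {0..T})"
        using integral_has_real_derivative[OF FX_cont[OF i] t] by (auto intro!: derivative_eq_intros)
      then show "((\<lambda>s. X s i) has_real_derivative F i (X t)) (at t within {0..T})"
        by (rule has_field_derivative_transform_within[where d = 1]) (use integral_eq i t in auto)
    qed
  qed
qed

section \<open>Lipschitz dependence of the curvature on the weights\<close>

text \<open>
  Boundedness is included because it makes the class closed under products. Points are compared in the
  sum norm over the coordinates in \<open>I\<close>; the other coordinates are irrelevant.
\<close>

definition bounded_lipschitz_on ::
  "'i set \<Rightarrow> ('i \<Rightarrow> real) set \<Rightarrow> (('i \<Rightarrow> real) \<Rightarrow> real) \<Rightarrow> bool" where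
  "bounded_lipschitz_on I B f \<longleftrightarrow>
     (\<exists>M. \<forall>u\<in>B. \<bar>f u\<bar> \<le> M) \<and>
     (\<exists>L\<ge>0. \<forall>u\<in>B. \<forall>v\<in>B. \<bar>f u - f v\<bar> \<le> L * (\<Sum>j\<in>I. \<bar>u j - v j\<bar>))"

lemma bounded_lipschitz_onI:
  assumes "\<And>u. u \<in> B \<Longrightarrow> \<bar>f u\<bar> \<le> M" "0 \<le> L"
    and "\<And>u v. \<lbrakk>u \<in> B; v \<in> B\<rbrakk> \<Longrightarrow> \<bar>f u - f v\<bar> \<le> L * (\<Sum>j\<in>I. \<bar>u j - v j\<bar>)"
  shows "bounded_lipschitz_on I B f"
  using assms unfolding bounded_lipschitz_on_def by blast

lemma bounded_lipschitz_onE: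
  assumes "bounded_lipschitz_on I B f"
  obtains M L where "\<forall>u\<in>B. \<bar>f u\<bar> \<le> M" "0 \<le> M" "0 \<le> L"
    and "\<forall>u\<in>B. \<forall>v\<in>B. \<bar>f u - f v\<bar> \<le> L * (\<Sum>j\<in>I. \<bar>u j - v j\<bar>)"
proof -
  obtain M where M: "\<forall>u\<in>B. \<bar>f u\<bar> \<le> M"
    using assms unfolding bounded_lipschitz_on_def by blast
  obtain L where L: "0 \<le> L" "\<forall>u\<in>B. \<forall>v\<in>B. \<bar>f u - f v\<bar> \<le> L * (\<Sum>j\<in>I. \<bar>u j - v j\<bar>)"
    using assms unfolding bounded_lipschitz_on_def by blast
  have "\<forall>u\<in>B. \<bar>f u\<bar> \<le> \<bar>M\<bar>"
    using M by force
  then show thesis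
    using that L by auto
qed

lemma bounded_lipschitz_on_cong:
  assumes "bounded_lipschitz_on I B f" "\<And>u. u \<in> B \<Longrightarrow> g u = f u"
  shows "bounded_lipschitz_on I B g"
  using assms by (simp add: bounded_lipschitz_on_def)

lemma bounded_lipschitz_on_const: "bounded_lipschitz_on I B (\<lambda>u. c)"
  by (rule bounded_lipschitz_onI[where M = "\<bar>c\<bar>" and L = 0]) auto

lemma bounded_lipschitz_on_coordinate:
  assumes "finite I" "i \<in> I" "\<And>u. u \<in> B \<Longrightarrow> \<bar>u i\<bar> \<le> M"
  shows "bounded_lipschitz_on I B (\<lambda>u. u i)"
proof (rule bounded_lipschitz_onI[where M = M and L = 1])
  show "\<bar>u i - v i\<bar> \<le> 1 * (\<Sum>j\<in>I. \<bar>u j - v j\<bar>)" for u v :: "'a \<Rightarrow> real"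
    using member_le_sum[of i I "\<lambda>j. \<bar>u j - v j\<bar>"] assms(1,2) by simp
qed (use assms(3) in auto)

lemma bounded_lipschitz_on_add:
  assumes "bounded_lipschitz_on I B f" "bounded_lipschitz_on I B g"
  shows "bounded_lipschitz_on I B (\<lambda>u. f u + g u)"
proof -
  obtain M L where f: "\<forall>u\<in>B. \<bar>f u\<bar> \<le> M" "0 \<le> M" "0 \<le> L"
    "\<forall>u\<in>B. \<forall>v\<in>B. \<bar>f u - f v\<bar> \<le> L * (\<Sum>j\<in>I. \<bar>u j - v j\<bar>)"
    using bounded_lipschitz_onE[OF assms(1)] .
  note f = f[rule_format]
  obtain M' L' where g: "\<forall>u\<in>B. \<bar>g u\<bar> \<le> M'" "0 \<le> M'" "0 \<le> L'"
    "\<forall>u\<in>B. \<forall>v\<in>B. \<bar>g u - g v\<bar> \<le> L' * (\<Sum>j\<in>I. \<bar>u j - v j\<bar>)"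
    using bounded_lipschitz_onE[OF assms(2)] .
  note g = g[rule_format]
  show ?thesis
  proof (rule bounded_lipschitz_onI[where M = "M + M'" and L = "L + L'"])
    show "\<bar>f u + g u\<bar> \<le> M + M'" if "u \<in> B" for u
      using f(1)[OF that] g(1)[OF that] by linarith
    show "\<bar>f u + g u - (f v + g v)\<bar> \<le> (L + L') * (\<Sum>j\<in>I. \<bar>u j - v j\<bar>)" if "u \<in> B" "v \<in> B" for u v
      using f(4)[OF that] g(4)[OF that] unfolding distrib_right by linarith
  qed (use f(3) g(3) in simp)
qed

lemma bounded_lipschitz_on_mult:
  assumes "bounded_lipschitz_on I B f" "bounded_lipschitz_on I B g"
  shows "bounded_lipschitz_on I B (\<lambda>u. f u * g u)"
proof -
  obtain M L where f: "\<forall>u\<in>B. \<bar>f u\<bar> \<le> M" "0 \<le> M" "0 \<le> L"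
    "\<forall>u\<in>B. \<forall>v\<in>B. \<bar>f u - f v\<bar> \<le> L * (\<Sum>j\<in>I. \<bar>u j - v j\<bar>)"
    using bounded_lipschitz_onE[OF assms(1)] .
  note f = f[rule_format]
  obtain M' L' where g: "\<forall>u\<in>B. \<bar>g u\<bar> \<le> M'" "0 \<le> M'" "0 \<le> L'"
    "\<forall>u\<in>B. \<forall>v\<in>B. \<bar>g u - g v\<bar> \<le> L' * (\<Sum>j\<in>I. \<bar>u j - v j\<bar>)"
    using bounded_lipschitz_onE[OF assms(2)] .
  note g = g[rule_format]
  show ?thesis
  proof (rule bounded_lipschitz_onI[where M = "M * M'" and L = "M * L' + M' * L"])
    show "\<bar>f u * g u\<bar> \<le> M * M'" if "u \<in> B" for u
      unfolding abs_mult using f(1)[OF that] g(1)[OF that] f(2) by (intro mult_mono) auto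
    fix u v assume uv: "u \<in> B" "v \<in> B"
    let ?d = "\<Sum>j\<in>I. \<bar>u j - v j\<bar>"
    have "f u * g u - f v * g v = f u * (g u - g v) + g v * (f u - f v)"
      by (simp add: algebra_simps)
    then have "\<bar>f u * g u - f v * g v\<bar> \<le> \<bar>f u\<bar> * \<bar>g u - g v\<bar> + \<bar>g v\<bar> * \<bar>f u - f v\<bar>"
      by (metis abs_mult abs_triangle_ineq)
    also have "\<dots> \<le> M * (L' * ?d) + M' * (L * ?d)"
      using f(1)[OF uv(1)] g(1)[OF uv(2)] f(4)[OF uv] g(4)[OF uv] f(2) g(2)
      by (intro add_mono mult_mono) auto
    finally show "\<bar>f u * g u - f v * g v\<bar> \<le> (M * L' + M' * L) * ?d"
      by (simp add: algebra_simps)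
  qed (use f(2,3) g(2,3) in simp)
qed

lemma bounded_lipschitz_on_diff:
  assumes "bounded_lipschitz_on I B f" "bounded_lipschitz_on I B g"
  shows "bounded_lipschitz_on I B (\<lambda>u. f u - g u)"
  using bounded_lipschitz_on_add[OF assms(1)
      bounded_lipschitz_on_mult[OF bounded_lipschitz_on_const[of _ _ "-1"] assms(2)]]
  by simp

lemma bounded_lipschitz_on_sum:
  assumes "\<And>a. a \<in> A \<Longrightarrow> bounded_lipschitz_on I B (f a)"
  shows "bounded_lipschitz_on I B (\<lambda>u. \<Sum>a\<in>A. f a u)"
  using assms
proof (induction A rule: infinite_finite_induct)
  case (insert a A)
  then show ?case
    by (simp add: bounded_lipschitz_on_add)
qed (simp_all add: bounded_lipschitz_on_const)

lemma bounded_lipschitz_on_min: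
  assumes "bounded_lipschitz_on I B f" "bounded_lipschitz_on I B g"
  shows "bounded_lipschitz_on I B (\<lambda>u. min (f u) (g u))"
proof -
  obtain M L where f: "\<forall>u\<in>B. \<bar>f u\<bar> \<le> M" "0 \<le> M" "0 \<le> L"
    "\<forall>u\<in>B. \<forall>v\<in>B. \<bar>f u - f v\<bar> \<le> L * (\<Sum>j\<in>I. \<bar>u j - v j\<bar>)"
    using bounded_lipschitz_onE[OF assms(1)] .
  note f = f[rule_format]
  obtain M' L' where g: "\<forall>u\<in>B. \<bar>g u\<bar> \<le> M'" "0 \<le> M'" "0 \<le> L'"
    "\<forall>u\<in>B. \<forall>v\<in>B. \<bar>g u - g v\<bar> \<le> L' * (\<Sum>j\<in>I. \<bar>u j - v j\<bar>)"
    using bounded_lipschitz_onE[OF assms(2)] .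
  note g = g[rule_format]
  show ?thesis
  proof (rule bounded_lipschitz_onI[where M = "M + M'" and L = "L + L'"])
    show "\<bar>min (f u) (g u)\<bar> \<le> M + M'" if "u \<in> B" for u
      using f(1)[OF that] g(1)[OF that] by linarith
    show "\<bar>min (f u) (g u) - min (f v) (g v)\<bar> \<le> (L + L') * (\<Sum>j\<in>I. \<bar>u j - v j\<bar>)"
      if "u \<in> B" "v \<in> B" for u v
      using f(4)[OF that] g(4)[OF that] unfolding distrib_right by linarith
  qed (use f(3) g(3) in simp)
qed

lemma bounded_lipschitz_on_Min:
  assumes "finite A" "A \<noteq> {}" "\<And>a. a \<in> A \<Longrightarrow> bounded_lipschitz_on I B (f a)"
  shows "bounded_lipschitz_on I B (\<lambda>u. Min ((\<lambda>a. f a u) ` A))"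
  using assms
proof (induction A rule: finite_ne_induct)
  case (insert a A)
  then show ?case
    by (simp add: bounded_lipschitz_on_min)
qed simp

lemma bounded_lipschitz_on_compose:
  assumes f: "bounded_lipschitz_on I B f" "\<And>u. u \<in> B \<Longrightarrow> f u \<in> S"
    and g: "K-lipschitz_on S g" "\<And>t. t \<in> S \<Longrightarrow> \<bar>g t\<bar> \<le> M"
  shows "bounded_lipschitz_on I B (\<lambda>u. g (f u))"
proof -
  obtain L where L: "0 \<le> L"
    "\<And>u v. \<lbrakk>u \<in> B; v \<in> B\<rbrakk> \<Longrightarrow> \<bar>f u - f v\<bar> \<le> L * (\<Sum>j\<in>I. \<bar>u j - v j\<bar>)"
    using f(1) unfolding bounded_lipschitz_on_def by blast
  have K: "0 \<le> K"
    using g(1) by (rule lipschitz_on_nonneg)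
  show ?thesis
  proof (rule bounded_lipschitz_onI[where M = M and L = "K * L"])
    fix u v assume uv: "u \<in> B" "v \<in> B"
    have "\<bar>g (f u) - g (f v)\<bar> \<le> K * \<bar>f u - f v\<bar>"
      using lipschitz_onD[OF g(1) f(2)[OF uv(1)] f(2)[OF uv(2)]] by (simp add: dist_real_def)
    also have "\<dots> \<le> K * (L * (\<Sum>j\<in>I. \<bar>u j - v j\<bar>))"
      using L(2)[OF uv] K by (rule mult_left_mono)
    finally show "\<bar>g (f u) - g (f v)\<bar> \<le> K * L * (\<Sum>j\<in>I. \<bar>u j - v j\<bar>)"
      by (simp add: mult.assoc)
  qed (use f(2) g(2) K L(1) in auto)
qed

lemma bounded_lipschitz_on_divide:
  assumes "bounded_lipschitz_on I B f" "bounded_lipschitz_on I B g"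
    and "0 < c" "\<And>u. u \<in> B \<Longrightarrow> c \<le> g u"
  shows "bounded_lipschitz_on I B (\<lambda>u. f u / g u)"
proof -
  have lip: "(1 / c\<^sup>2)-lipschitz_on {c..} (inverse :: real \<Rightarrow> real)"
  proof (rule lipschitz_onI)
    fix s t :: real assume st: "s \<in> {c..}" "t \<in> {c..}"
    then have "\<bar>inverse s - inverse t\<bar> = \<bar>s - t\<bar> / (s * t)"
      using assms(3) by (simp add: field_simps abs_mult abs_divide abs_minus_commute)
    also have "\<dots> \<le> \<bar>s - t\<bar> / c\<^sup>2"
      using st assms(3) by (intro divide_left_mono) (auto simp: power2_eq_square intro: mult_mono)
    finally show "dist (inverse s) (inverse t) \<le> 1 / c\<^sup>2 * dist s t"
      by (simp add: dist_real_def)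
  qed simp
  have bound: "\<bar>inverse t\<bar> \<le> inverse c" if "t \<in> {c..}" for t
    using that assms(3) by (simp add: le_imp_inverse_le)
  have "bounded_lipschitz_on I B (\<lambda>u. inverse (g u))"
    by (rule bounded_lipschitz_on_compose[OF assms(2) _ lip bound]) (use assms(4) in simp_all)
  then show ?thesis
    unfolding divide_inverse by (rule bounded_lipschitz_on_mult[OF assms(1)])
qed

text \<open>
  One constant serves a whole finite family: this gives the uniform constants that the perturbation
  estimate for the transport cost and the differential equation require.
\<close>

lemma lipschitz_sum_of_differences:
  assumes "finite A" "\<And>a. a \<in> A \<Longrightarrow> bounded_lipschitz_on I B (f a)"
  obtains L where "0 \<le> L"
    "\<forall>u\<in>B. \<forall>v\<in>B. (\<Sum>a\<in>A. \<bar>f a u - f a v\<bar>) \<le> L * (\<Sum>j\<in>I. \<bar>u j - v j\<bar>)"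
proof -
  have "\<exists>L\<ge>0. \<forall>u\<in>B. \<forall>v\<in>B. (\<Sum>a\<in>A. \<bar>f a u - f a v\<bar>) \<le> L * (\<Sum>j\<in>I. \<bar>u j - v j\<bar>)"
    using assms
  proof (induction A rule: finite_induct)
    case (insert b A)
    obtain L where L: "0 \<le> L" "\<forall>u\<in>B. \<forall>v\<in>B. (\<Sum>a\<in>A. \<bar>f a u - f a v\<bar>) \<le> L * (\<Sum>j\<in>I. \<bar>u j - v j\<bar>)"
      using insert by auto
    obtain L' where L': "0 \<le> L'"
      "\<And>u v. \<lbrakk>u \<in> B; v \<in> B\<rbrakk> \<Longrightarrow> \<bar>f b u - f b v\<bar> \<le> L' * (\<Sum>j\<in>I. \<bar>u j - v j\<bar>)"
      using insert.prems[of b] unfolding bounded_lipschitz_on_def by blast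
    show ?case
    proof (intro exI[of _ "L' + L"] conjI ballI)
      fix u v assume "u \<in> B" "v \<in> B"
      then show "(\<Sum>a\<in>insert b A. \<bar>f a u - f a v\<bar>) \<le> (L' + L) * (\<Sum>j\<in>I. \<bar>u j - v j\<bar>)"
        using L L' insert.hyps by (simp add: distrib_right add_mono)
    qed (use L(1) L'(1) in simp)
  qed auto
  then show thesis using that by blast
qed

text \<open>
  A uniform bound \<open>D\<close> on the costs comes from their total over all pairs, which dominates each of them.
\<close>

lemma bounded_lipschitz_on_optimal_cost:
  assumes V: "finite V"
    and p: "\<And>u. u \<in> B \<Longrightarrow> prob_on V (\<mu> u)" "\<And>u. u \<in> B \<Longrightarrow> prob_on V (\<nu> u)"
    and c_nonneg: "\<And>u x y. \<lbrakk>u \<in> B; x \<in> V; y \<in> V\<rbrakk> \<Longrightarrow> 0 \<le> c u x y"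
    and \<mu>: "\<And>x. x \<in> V \<Longrightarrow> bounded_lipschitz_on I B (\<lambda>u. \<mu> u x)"
    and \<nu>: "\<And>x. x \<in> V \<Longrightarrow> bounded_lipschitz_on I B (\<lambda>u. \<nu> u x)"
    and c: "\<And>x y. \<lbrakk>x \<in> V; y \<in> V\<rbrakk> \<Longrightarrow> bounded_lipschitz_on I B (\<lambda>u. c u x y)"
  shows "bounded_lipschitz_on I B (\<lambda>u. optimal_cost V (c u) (\<mu> u) (\<nu> u))"
proof -
  have total: "bounded_lipschitz_on I B (\<lambda>u. \<Sum>x\<in>V. \<Sum>y\<in>V. c u x y)"
    by (intro bounded_lipschitz_on_sum c)
  obtain D L\<^sub>0 where D: "\<forall>u\<in>B. \<bar>\<Sum>x\<in>V. \<Sum>y\<in>V. c u x y\<bar> \<le> D" "0 \<le> D" "0 \<le> L\<^sub>0"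
    "\<forall>u\<in>B. \<forall>v\<in>B. \<bar>(\<Sum>x\<in>V. \<Sum>y\<in>V. c u x y) - (\<Sum>x\<in>V. \<Sum>y\<in>V. c v x y)\<bar>
      \<le> L\<^sub>0 * (\<Sum>j\<in>I. \<bar>u j - v j\<bar>)"
    using bounded_lipschitz_onE[OF total] .
  note D = D[rule_format]
  have c_le: "c u x y \<le> D" if "u \<in> B" "x \<in> V" "y \<in> V" for u x y
  proof -
    have "c u x y \<le> (\<Sum>y\<in>V. c u x y)"
      using that V c_nonneg by (intro member_le_sum) auto
    also have "\<dots> \<le> (\<Sum>x\<in>V. \<Sum>y\<in>V. c u x y)"
      using that V c_nonneg by (intro member_le_sum[where f = "\<lambda>x. \<Sum>y\<in>V. c u x y"] sum_nonneg) auto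
    finally show ?thesis
      using D(1)[OF that(1)] by linarith
  qed
  obtain L\<^sub>\<mu> where L\<^sub>\<mu>: "0 \<le> L\<^sub>\<mu>"
    "\<forall>u\<in>B. \<forall>v\<in>B. (\<Sum>x\<in>V. \<bar>\<mu> u x - \<mu> v x\<bar>) \<le> L\<^sub>\<mu> * (\<Sum>j\<in>I. \<bar>u j - v j\<bar>)"
    using lipschitz_sum_of_differences[OF V \<mu>] .
  note L\<^sub>\<mu> = L\<^sub>\<mu>[rule_format]
  obtain L\<^sub>\<nu> where L\<^sub>\<nu>: "0 \<le> L\<^sub>\<nu>"
    "\<forall>u\<in>B. \<forall>v\<in>B. (\<Sum>x\<in>V. \<bar>\<nu> u x - \<nu> v x\<bar>) \<le> L\<^sub>\<nu> * (\<Sum>j\<in>I. \<bar>u j - v j\<bar>)"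
    using lipschitz_sum_of_differences[OF V \<nu>] .
  note L\<^sub>\<nu> = L\<^sub>\<nu>[rule_format]
  have pairs: "finite (V \<times> V)" "\<And>z. z \<in> V \<times> V \<Longrightarrow> bounded_lipschitz_on I B (\<lambda>u. c u (fst z) (snd z))"
    using V by (auto intro: c)
  obtain L\<^sub>c where L\<^sub>c: "0 \<le> L\<^sub>c"
    "\<forall>u\<in>B. \<forall>v\<in>B. (\<Sum>z\<in>V \<times> V. \<bar>c u (fst z) (snd z) - c v (fst z) (snd z)\<bar>)
      \<le> L\<^sub>c * (\<Sum>j\<in>I. \<bar>u j - v j\<bar>)"
    using lipschitz_sum_of_differences[OF pairs] .
  note L\<^sub>c = L\<^sub>c[rule_format]
  let ?W = "\<lambda>u. optimal_cost V (c u) (\<mu> u) (\<nu> u)"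
  let ?L = "L\<^sub>c + D * (L\<^sub>\<mu> + L\<^sub>\<nu>)"
  have W_le: "?W v - ?W u \<le> ?L * (\<Sum>j\<in>I. \<bar>u j - v j\<bar>)" if uv: "u \<in> B" "v \<in> B" for u v
  proof -
    have "?W v \<le> ?W u + (\<Sum>x\<in>V. \<Sum>y\<in>V. \<bar>c u x y - c v x y\<bar>)
        + D * ((\<Sum>x\<in>V. \<bar>\<mu> u x - \<mu> v x\<bar>) + (\<Sum>x\<in>V. \<bar>\<nu> u x - \<nu> v x\<bar>))"
      by (rule optimal_cost_perturb) (use V p uv c_nonneg c_le in auto)
    moreover have "(\<Sum>x\<in>V. \<Sum>y\<in>V. \<bar>c u x y - c v x y\<bar>) \<le> L\<^sub>c * (\<Sum>j\<in>I. \<bar>u j - v j\<bar>)"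
      using L\<^sub>c(2)[OF uv] by (simp add: sum.cartesian_product case_prod_unfold)
    moreover have "D * ((\<Sum>x\<in>V. \<bar>\<mu> u x - \<mu> v x\<bar>) + (\<Sum>x\<in>V. \<bar>\<nu> u x - \<nu> v x\<bar>))
        \<le> D * (L\<^sub>\<mu> * (\<Sum>j\<in>I. \<bar>u j - v j\<bar>) + L\<^sub>\<nu> * (\<Sum>j\<in>I. \<bar>u j - v j\<bar>))"
      using L\<^sub>\<mu>(2)[OF uv] L\<^sub>\<nu>(2)[OF uv] D(2) by (intro mult_left_mono add_mono)
    ultimately show ?thesis by (simp add: algebra_simps)
  qed
  show ?thesis
  proof (rule bounded_lipschitz_onI[where M = D and L = ?L])
    fix u assume u: "u \<in> B"
    have "0 \<le> ?W u"
      using u c_nonneg by (intro optimal_cost_greatest p transport_cost_nonneg) auto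
    moreover have "?W u \<le> D"
    proof -
      note prod = product_coupling[OF p(1)[OF u] p(2)[OF u]]
      have "?W u \<le> transport_cost V (c u) (\<lambda>x y. \<mu> u x * \<nu> u y)"
        using prod c_nonneg[OF u] by (rule optimal_cost_le)
      also have "\<dots> \<le> D"
        using p(1)[OF u] prod c_le[OF u] by (rule transport_cost_le)
      finally show ?thesis .
    qed
    ultimately show "\<bar>?W u\<bar> \<le> D" by simp
  next
    fix u v assume uv: "u \<in> B" "v \<in> B"
    show "\<bar>?W u - ?W v\<bar> \<le> ?L * (\<Sum>j\<in>I. \<bar>u j - v j\<bar>)"
      using W_le[OF uv] W_le[OF uv(2,1)] by (simp add: abs_le_iff abs_minus_commute)
  qed (use L\<^sub>c(1) L\<^sub>\<mu>(1) L\<^sub>\<nu>(1) D(2) in simp)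
qed

text \<open>
  Scale invariance is assumed for the edges of the given graph, which is where the flow uses it.
\<close>

locale scale_invariant_walk = weighted_walk V E \<gamma>
  for V :: "'a set" and E :: "'a set set" and \<gamma> :: "real \<Rightarrow> real" +
  assumes curvature_scale: "\<lbrakk>\<forall>e\<in>E. 0 < w e; 0 < c; {x, y} \<in> E\<rbrakk> \<Longrightarrow>
      olly_curvature \<gamma> V E (\<lambda>e. c * w e) x y = olly_curvature \<gamma> V E w x y"
    and gamma_lipschitz: "0 < \<delta> \<Longrightarrow> \<exists>L. L-lipschitz_on {\<delta>..1} \<gamma>"
begin

definition edge_box :: "real \<Rightarrow> real \<Rightarrow> ('a set \<Rightarrow> real) set" where
  "edge_box a b = {w. \<forall>e\<in>E. a \<le> w e \<and> w e \<le> b}"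

lemma edge_box_pos: "\<lbrakk>w \<in> edge_box a b; 0 < a\<rbrakk> \<Longrightarrow> \<forall>e\<in>E. 0 < w e"
  by (fastforce simp: edge_box_def)

lemma bounded_lipschitz_on_weight:
  assumes "e \<in> E"
  shows "bounded_lipschitz_on E (edge_box a b) (\<lambda>w. w e)"
  using assms finite_E
  by (intro bounded_lipschitz_on_coordinate[where M = "\<bar>a\<bar> + \<bar>b\<bar>"]) (force simp: edge_box_def)+

lemma bounded_lipschitz_on_wdist:
  assumes "x \<in> V" "y \<in> V"
  shows "bounded_lipschitz_on E (edge_box a b) (\<lambda>w. wdist E w x y)"
  unfolding wdist_def
proof (rule bounded_lipschitz_on_Min)
  fix p assume "p \<in> {p. joining_path E x y p}"
  then have "set (path_edges p) \<subseteq> E"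
    using joining_path_edges by simp
  moreover have "bounded_lipschitz_on E (edge_box a b) (\<lambda>w. sum_list (map w es))" if "set es \<subseteq> E" for es
    using that
    by (induction es)
       (simp_all add: bounded_lipschitz_on_const bounded_lipschitz_on_add bounded_lipschitz_on_weight)
  ultimately show "bounded_lipschitz_on E (edge_box a b) (\<lambda>w. path_weight w p)"
    unfolding path_weight_eq by blast
qed (use finite_joining_paths connected assms in auto)

text \<open>
  The denominator, the weighted degree, stays away from \<open>0\<close>: it contains the term of the edge \<open>xy\<close>, and a
  positive continuous function has a positive minimum on \<open>[a, 1]\<close>.
\<close>

lemma bounded_lipschitz_on_walk_measure:
  assumes "0 < a" "a \<le> 1" "{x, y} \<in> E"
  shows "bounded_lipschitz_on E (edge_box a 1) (\<lambda>w. walk_measure \<gamma> E w \<alpha> x z)"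
proof -
  obtain K where K: "K-lipschitz_on {a..1} \<gamma>"
    using gamma_lipschitz[OF assms(1)] by blast
  then have cont: "continuous_on {a..1} \<gamma>"
    by (rule lipschitz_on_continuous_on)
  obtain t where t: "t \<in> {a..1}" "\<And>s. s \<in> {a..1} \<Longrightarrow> \<gamma> t \<le> \<gamma> s"
    using continuous_attains_inf[OF _ _ cont] assms by auto
  obtain t' where t': "t' \<in> {a..1}" "\<And>s. s \<in> {a..1} \<Longrightarrow> \<gamma> s \<le> \<gamma> t'"
    using continuous_attains_sup[OF _ _ cont] assms by auto
  have pos: "0 < \<gamma> s" if "s \<in> {a..1}" for s
    using that assms(1) gamma_pos by simp
  have \<gamma>: "bounded_lipschitz_on E (edge_box a 1) (\<lambda>w. \<gamma> (w e))" if "e \<in> E" for e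
  proof (rule bounded_lipschitz_on_compose[OF bounded_lipschitz_on_weight[OF that] _ K])
    show "\<bar>\<gamma> s\<bar> \<le> \<gamma> t'" if "s \<in> {a..1}" for s
      using pos[OF that] t'(2)[OF that] by simp
  qed (use that in \<open>auto simp: edge_box_def\<close>)
  show ?thesis
  proof (cases "z \<noteq> x \<and> {x, z} \<in> E")
    case True
    have degree_ge: "\<gamma> t \<le> (\<Sum>z | {x, z} \<in> E. \<gamma> (w {x, z}))" if w: "w \<in> edge_box a 1" for w
    proof -
      have box: "\<And>e. e \<in> E \<Longrightarrow> w e \<in> {a..1}"
        using w by (auto simp: edge_box_def)
      have "\<gamma> t \<le> \<gamma> (w {x, y})"
        using box assms(3) t(2) by blast
      also have "\<dots> \<le> (\<Sum>z | {x, z} \<in> E. \<gamma> (w {x, z}))"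
        using box assms(3) neighbours(2) pos
        by (intro member_le_sum[where f = "\<lambda>z. \<gamma> (w {x, z})"]) (auto intro: less_imp_le)
      finally show ?thesis .
    qed
    have degree: "bounded_lipschitz_on E (edge_box a 1) (\<lambda>w. \<Sum>z | {x, z} \<in> E. \<gamma> (w {x, z}))"
      by (rule bounded_lipschitz_on_sum) (simp add: \<gamma>)
    have "bounded_lipschitz_on E (edge_box a 1) (\<lambda>w. \<gamma> (w {x, z}))"
      using True by (simp add: \<gamma>)
    then have "bounded_lipschitz_on E (edge_box a 1)
        (\<lambda>w. (1 - \<alpha>) * (\<gamma> (w {x, z}) / (\<Sum>z | {x, z} \<in> E. \<gamma> (w {x, z}))))"
      by (intro bounded_lipschitz_on_mult[OF bounded_lipschitz_on_const]
          bounded_lipschitz_on_divide[OF _ degree pos[OF t(1)] degree_ge])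
    then show ?thesis
      using True by (simp add: walk_measure_def)
  next
    case False
    then have "walk_measure \<gamma> E w \<alpha> x z = (if z = x then \<alpha> else 0)" for w
      by (auto simp: walk_measure_def)
    then show ?thesis
      by (simp add: bounded_lipschitz_on_const)
  qed
qed

lemma bounded_lipschitz_on_curvature_unit:
  assumes "0 < a" "a \<le> 1" "{x, y} \<in> E"
  shows "bounded_lipschitz_on E (edge_box a 1) (\<lambda>w. olly_curvature \<gamma> V E w x y)"
proof -
  have yx: "{y, x} \<in> E"
    using assms(3) by (simp add: insert_commute)
  note ends = edge_ends[OF assms(3)]
  note pos = edge_box_pos[OF _ assms(1)]
  have "bounded_lipschitz_on E (edge_box a 1) (\<lambda>w. lazy_cost w x y)"
    unfolding lazy_cost_def wasserstein_eq_optimal_cost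
  proof (rule bounded_lipschitz_on_optimal_cost[OF finite_V])
    show "prob_on V (walk_measure \<gamma> E w (1 / 2) x)" if "w \<in> edge_box a 1" for w
      using prob_on_walk_measure[OF pos[OF that] assms(3)] by simp
    show "prob_on V (walk_measure \<gamma> E w (1 / 2) y)" if "w \<in> edge_box a 1" for w
      using prob_on_walk_measure[OF pos[OF that] yx] by simp
    show "0 \<le> wdist E w u v" if "w \<in> edge_box a 1" "u \<in> V" "v \<in> V" for w u v
      using pos[OF that(1)] that(2,3) by (rule wdist_nonneg)
    show "bounded_lipschitz_on E (edge_box a 1) (\<lambda>w. walk_measure \<gamma> E w (1 / 2) x z)" for z
      by (rule bounded_lipschitz_on_walk_measure[OF assms])
    show "bounded_lipschitz_on E (edge_box a 1) (\<lambda>w. walk_measure \<gamma> E w (1 / 2) y z)" for z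
      by (rule bounded_lipschitz_on_walk_measure[OF assms(1,2) yx])
    show "bounded_lipschitz_on E (edge_box a 1) (\<lambda>w. wdist E w u v)" if "u \<in> V" "v \<in> V" for u v
      using that by (rule bounded_lipschitz_on_wdist)
  qed
  moreover have "a \<le> wdist E w x y" if "w \<in> edge_box a 1" for w
    using that assms(1) ends by (intro wdist_ge) (auto simp: edge_box_def)
  ultimately have "bounded_lipschitz_on E (edge_box a 1) (\<lambda>w. 2 * (1 - lazy_cost w x y / wdist E w x y))"
    by (intro bounded_lipschitz_on_mult[OF bounded_lipschitz_on_const]
        bounded_lipschitz_on_diff[OF bounded_lipschitz_on_const]
        bounded_lipschitz_on_divide[OF _ bounded_lipschitz_on_wdist[OF ends(1,2)] assms(1)])
  then show ?thesis
    by (rule bounded_lipschitz_on_cong) (rule olly_curvature_eq[OF pos assms(3)])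
qed

text \<open>
  Division of all weights by \<open>b\<close> maps the box \<open>[a, b]\<close> into \<open>[a/b, 1]\<close>, where \<open>\<gamma>\<close> is known to be
  Lipschitz, and leaves the curvature unchanged.
\<close>

lemma bounded_lipschitz_on_curvature:
  assumes "0 < a" "a \<le> b" "{x, y} \<in> E"
  shows "bounded_lipschitz_on E (edge_box a b) (\<lambda>w. olly_curvature \<gamma> V E w x y)"
proof -
  let ?s = "\<lambda>w e. (1 / b) * w e"
  have unit: "bounded_lipschitz_on E (edge_box (a / b) 1) (\<lambda>w. olly_curvature \<gamma> V E w x y)"
    using assms by (intro bounded_lipschitz_on_curvature_unit) auto
  obtain M L where L: "\<forall>w\<in>edge_box (a / b) 1. \<bar>olly_curvature \<gamma> V E w x y\<bar> \<le> M"
    "0 \<le> M" "0 \<le> L"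
    "\<forall>w\<in>edge_box (a / b) 1. \<forall>w'\<in>edge_box (a / b) 1.
      \<bar>olly_curvature \<gamma> V E w x y - olly_curvature \<gamma> V E w' x y\<bar> \<le> L * (\<Sum>e\<in>E. \<bar>w e - w' e\<bar>)"
    using bounded_lipschitz_onE[OF unit] .
  note L = L[rule_format]
  have box: "?s w \<in> edge_box (a / b) 1" if "w \<in> edge_box a b" for w
    using that assms by (auto simp: edge_box_def divide_simps)
  have scale: "olly_curvature \<gamma> V E w x y = olly_curvature \<gamma> V E (?s w) x y" if "w \<in> edge_box a b" for w
    using curvature_scale[OF edge_box_pos[OF that assms(1)] _ assms(3), of "1 / b"] assms by simp
  show ?thesis
  proof (rule bounded_lipschitz_onI[where M = M and L = "L / b"])
    show "\<bar>olly_curvature \<gamma> V E w x y\<bar> \<le> M" if "w \<in> edge_box a b" for w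
      unfolding scale[OF that] using L(1)[OF box[OF that]] .
    fix w w' assume w: "w \<in> edge_box a b" "w' \<in> edge_box a b"
    have "\<bar>olly_curvature \<gamma> V E w x y - olly_curvature \<gamma> V E w' x y\<bar> \<le> L * (\<Sum>e\<in>E. \<bar>?s w e - ?s w' e\<bar>)"
      unfolding scale[OF w(1)] scale[OF w(2)] using L(4)[OF box[OF w(1)] box[OF w(2)]] .
    also have "(\<Sum>e\<in>E. \<bar>?s w e - ?s w' e\<bar>) = (\<Sum>e\<in>E. \<bar>w e - w' e\<bar> / b)"
    proof (rule sum.cong[OF refl])
      fix e
      have "?s w e - ?s w' e = (w e - w' e) / b"
        by (simp add: diff_divide_distrib)
      then show "\<bar>?s w e - ?s w' e\<bar> = \<bar>w e - w' e\<bar> / b"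
        using assms by (simp add: abs_divide)
    qed
    finally show "\<bar>olly_curvature \<gamma> V E w x y - olly_curvature \<gamma> V E w' x y\<bar>
        \<le> L / b * (\<Sum>e\<in>E. \<bar>w e - w' e\<bar>)"
      by (simp flip: sum_divide_distrib)
  qed (use assms L(3) in simp)
qed

text \<open>
  The orientation of the edge is chosen arbitrarily; for positive weights the choice has no effect.
\<close>

definition edge_curvature :: "('a set \<Rightarrow> real) \<Rightarrow> 'a set \<Rightarrow> real" where
  "edge_curvature w e =
     (case SOME (x, y). e = {x, y} of (x, y) \<Rightarrow> olly_curvature \<gamma> V E w x y)"

lemma edge_curvature_eq:
  assumes "\<forall>e\<in>E. 0 < w e" "{x, y} \<in> E"
  shows "edge_curvature w {x, y} = olly_curvature \<gamma> V E w x y"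
proof -
  obtain x' y' where s: "(SOME (x', y'). {x, y} = {x', y'}) = (x', y')"
    by fastforce
  have "case (SOME (x', y'). {x, y} = {x', y'}) of (x', y') \<Rightarrow> {x, y} = {x', y'}"
    by (rule someI[of _ "(x, y)"]) simp
  then have "{x, y} = {x', y'}" by (simp add: s)
  then have "x = x' \<and> y = y' \<or> x = y' \<and> y = x'"
    by (simp add: doubleton_eq_iff)
  then show ?thesis
    using olly_curvature_commute[OF assms] by (auto simp: edge_curvature_def s)
qed

definition flow_field :: "'a set \<Rightarrow> ('a set \<Rightarrow> real) \<Rightarrow> real" where
  "flow_field e w = - edge_curvature w e * w e"

lemma flow_field_lipschitz:
  assumes "0 < a" "a \<le> b"
  obtains L where "0 \<le> L"
    "\<forall>e\<in>E. \<forall>w\<in>edge_box a b. \<forall>w'\<in>edge_box a b.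
      \<bar>flow_field e w - flow_field e w'\<bar> \<le> L * (\<Sum>j\<in>E. \<bar>w j - w' j\<bar>)"
proof -
  have field: "bounded_lipschitz_on E (edge_box a b) (flow_field e)" if e: "e \<in> E" for e
  proof -
    obtain x y where xy: "e = {x, y}"
      using edge_card[OF e] by (auto simp: card_2_iff)
    have "bounded_lipschitz_on E (edge_box a b) (\<lambda>w. (0 - olly_curvature \<gamma> V E w x y) * w e)"
      using assms e unfolding xy
      by (intro bounded_lipschitz_on_mult bounded_lipschitz_on_diff[OF bounded_lipschitz_on_const]
          bounded_lipschitz_on_curvature bounded_lipschitz_on_weight)
    then show ?thesis
    proof (rule bounded_lipschitz_on_cong)
      show "flow_field e w = (0 - olly_curvature \<gamma> V E w x y) * w e" if "w \<in> edge_box a b" for w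
        using edge_curvature_eq[OF edge_box_pos[OF that assms(1)], of x y] e
        by (simp add: flow_field_def xy)
    qed
  qed
  obtain L where L: "0 \<le> L" "\<forall>w\<in>edge_box a b. \<forall>w'\<in>edge_box a b.
      (\<Sum>e\<in>E. \<bar>flow_field e w - flow_field e w'\<bar>) \<le> L * (\<Sum>j\<in>E. \<bar>w j - w' j\<bar>)"
    using lipschitz_sum_of_differences[OF finite_E field] .
  note L = L[rule_format]
  show thesis
  proof (rule that[OF L(1)], intro ballI)
    fix e w w' assume e: "e \<in> E" and w: "w \<in> edge_box a b" "w' \<in> edge_box a b"
    have "\<bar>flow_field e w - flow_field e w'\<bar> \<le> (\<Sum>e\<in>E. \<bar>flow_field e w - flow_field e w'\<bar>)"
      using e finite_E by (intro member_le_sum[where f = "\<lambda>e. \<bar>flow_field e w - flow_field e w'\<bar>"]) auto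
    then show "\<bar>flow_field e w - flow_field e w'\<bar> \<le> L * (\<Sum>j\<in>E. \<bar>w j - w' j\<bar>)"
      using L(2)[OF w] by linarith
  qed
qed

end

section \<open>Long-time existence and uniqueness of the flow\<close>

lemma time_interval_ereal: "time_interval (ereal T) = {0..<T}"
  by (auto simp: time_interval_def)

lemma time_interval_infinity: "time_interval \<infinity> = {0..}"
  by (auto simp: time_interval_def)

lemma Icc_subset_time_interval: "t \<in> time_interval T \<Longrightarrow> {0..t} \<subseteq> time_interval T"
  unfolding time_interval_def using order_le_less_trans[of "ereal _" "ereal t" T] by fastforce

locale ricci_flow = scale_invariant_walk V E \<gamma>
  for V :: "'a set" and E :: "'a set set" and \<gamma> :: "real \<Rightarrow> real" +
  fixes w\<^sub>0 :: "'a set \<Rightarrow> real"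
  assumes edges_nonempty: "E \<noteq> {}"
    and init_pos: "\<forall>e\<in>E. 0 < w\<^sub>0 e"
    and init_sum: "(\<Sum>e\<in>E. w\<^sub>0 e) = 1"
    and edges_shortest: "\<lbrakk>0 < T; ricci_flow_solution \<gamma> V E w\<^sub>0 T X; t \<in> time_interval T; {u, v} \<in> E\<rbrakk>
      \<Longrightarrow> X t {u, v} = wdist E (X t) u v"
begin

abbreviation solution :: "ereal \<Rightarrow> (real \<Rightarrow> 'a set \<Rightarrow> real) \<Rightarrow> bool" where
  "solution \<equiv> ricci_flow_solution \<gamma> V E w\<^sub>0"

text \<open>
  The flow equation as a system with one equation for each unordered edge, the form to which the
  theorems on differential equations apply.
\<close>

lemma solution_iff:
  "solution T X \<longleftrightarrow>
     (\<forall>e\<in>E. X 0 e = w\<^sub>0 e) \<and>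
     (\<forall>t\<in>time_interval T. \<forall>e\<in>E. 0 < X t e \<and>
       ((\<lambda>s. X s e) has_real_derivative flow_field e (X t)) (at t within time_interval T))"
  (is "_ \<longleftrightarrow> ?init \<and> (\<forall>t\<in>?I. \<forall>e\<in>E. ?pos t e \<and> ?deriv t e)")
proof -
  have deriv: "((\<lambda>s. X s {x, y}) has_real_derivative - olly_curvature \<gamma> V E (X t) x y * X t {x, y})
      (at t within ?I) \<longleftrightarrow> ?deriv t {x, y}" if "\<forall>e\<in>E. ?pos t e" "{x, y} \<in> E" for t x y
    using edge_curvature_eq[OF that] by (simp add: flow_field_def)
  show ?thesis
  proof
    assume X: "solution T X"
    have pos: "\<forall>e\<in>E. ?pos t e" if "t \<in> ?I" for t
      using X that by (simp add: ricci_flow_solution_def)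
    have "?deriv t e" if t: "t \<in> ?I" and e: "e \<in> E" for t e
    proof -
      obtain x y where xy: "e = {x, y}"
        using edge_card[OF e] by (auto simp: card_2_iff)
      show ?thesis
        using X t e deriv[OF pos[OF t], of x y] unfolding xy ricci_flow_solution_def by blast
    qed
    then show "?init \<and> (\<forall>t\<in>?I. \<forall>e\<in>E. ?pos t e \<and> ?deriv t e)"
      using X pos by (simp add: ricci_flow_solution_def)
  next
    assume X: "?init \<and> (\<forall>t\<in>?I. \<forall>e\<in>E. ?pos t e \<and> ?deriv t e)"
    show "solution T X"
      unfolding ricci_flow_solution_def
    proof (intro conjI ballI allI impI)
      fix t x y assume t: "t \<in> ?I" and xy: "{x, y} \<in> E"
      have "\<forall>e\<in>E. ?pos t e"
        using X t by blast
      then show "((\<lambda>s. X s {x, y}) has_real_derivative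
          - olly_curvature \<gamma> V E (X t) x y * X t {x, y}) (at t within ?I)"
        using X t xy deriv by blast
    qed (use X in blast)+
  qed
qed

lemma solution_init: "\<lbrakk>solution T X; e \<in> E\<rbrakk> \<Longrightarrow> X 0 e = w\<^sub>0 e"
  and solution_pos: "\<lbrakk>solution T X; t \<in> time_interval T; e \<in> E\<rbrakk> \<Longrightarrow> 0 < X t e"
  and solution_deriv: "\<lbrakk>solution T X; t \<in> time_interval T; e \<in> E\<rbrakk> \<Longrightarrow>
    ((\<lambda>s. X s e) has_real_derivative flow_field e (X t)) (at t within time_interval T)"
  by (auto simp: solution_iff)

lemma solution_deriv_Icc:
  assumes "solution T X" "t \<in> time_interval T" "s \<in> {0..t}" "e \<in> E"
  shows "((\<lambda>s. X s e) has_real_derivative flow_field e (X s)) (at s within {0..t})"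
  using solution_deriv[OF assms(1) _ assms(4)] Icc_subset_time_interval[OF assms(2)] assms(3)
  by (meson DERIV_subset subsetD)

definition growth_rate :: real where
  "growth_rate = 2 * card V * card E"

lemma growth_rate_nonneg: "0 \<le> growth_rate"
  by (simp add: growth_rate_def)

text \<open>
  For a shortest edge the denominator \<open>d(x, y)\<close> of the curvature cancels against the weight, and the
  field becomes \<open>2 W - 2 w\<close>, which is linearly bounded.
\<close>

lemma flow_field_bounds:
  fixes w :: "'a set \<Rightarrow> real"
  assumes w: "\<forall>e\<in>E. 0 < w e" and e: "e \<in> E"
    and shortest: "\<And>x y. {x, y} \<in> E \<Longrightarrow> w {x, y} = wdist E w x y"
  shows "- 2 * w e \<le> flow_field e w" "flow_field e w \<le> 2 * card V * sum w E"
proof -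
  obtain x y where xy: "e = {x, y}"
    using edge_card[OF e] by (auto simp: card_2_iff)
  have xyE: "{x, y} \<in> E"
    using e xy by simp
  have pos: "0 < w {x, y}"
    using w xyE by blast
  have field: "flow_field e w = 2 * lazy_cost w x y - 2 * w e"
    using pos shortest[OF xyE]
    by (simp add: flow_field_def xy edge_curvature_eq[OF w xyE] olly_curvature_eq[OF w xyE] field_simps)
  show "- 2 * w e \<le> flow_field e w"
    using field lazy_cost_bounds(1)[OF w xyE] by simp
  show "flow_field e w \<le> 2 * card V * sum w E"
    using field lazy_cost_bounds(2)[OF w xyE] pos xy by simp
qed

text \<open>
  Since \<open>- 2 w\<close> bounds the field from below, each weight dominates the solution of \<open>w' = - 2 w\<close>. The
  sum of the upper bounds over all edges is a linear differential inequality for the total weight, which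
  starts at \<open>1\<close>.
\<close>

lemma solution_bounds:
  assumes X: "solution T X" and t: "t \<in> time_interval T" and e: "e \<in> E"
  shows "w\<^sub>0 e * exp (- 2 * t) \<le> X t e" "X t e \<le> exp (growth_rate * t)"
proof -
  have t0: "0 \<le> t"
    using t by (simp add: time_interval_def)
  have "0 \<le> ereal t" "ereal t < T"
    using t by (simp_all add: time_interval_def)
  then have T: "0 < T"
    by (rule order_le_less_trans)
  have sub: "s \<in> time_interval T" if "s \<in> {0..t}" for s
    using Icc_subset_time_interval[OF t] that by blast
  have bounds: "- 2 * X s e \<le> flow_field e (X s)" "flow_field e (X s) \<le> 2 * card V * sum (X s) E"
    if "s \<in> {0..t}" "e \<in> E" for s e
  proof -
    have "\<forall>e\<in>E. 0 < X s e"
      using solution_pos[OF X sub[OF that(1)]] by blast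
    note field = flow_field_bounds[OF this that(2) edges_shortest[OF T X sub[OF that(1)]]]
    show "- 2 * X s e \<le> flow_field e (X s)" "flow_field e (X s) \<le> 2 * card V * sum (X s) E"
      by (rule field, assumption)+
  qed
  have "- X t e \<le> - X 0 e * exp (- 2 * t)"
  proof (rule gronwall_nonneg_growth[OF t0])
    fix s assume s: "s \<in> {0..t}"
    show "((\<lambda>s. - X s e) has_real_derivative - flow_field e (X s)) (at s within {0..t})"
      by (intro DERIV_minus solution_deriv_Icc[OF X t s e])
    show "- flow_field e (X s) \<le> - 2 * - X s e"
      using bounds(1)[OF s e] by simp
  qed
  then show "w\<^sub>0 e * exp (- 2 * t) \<le> X t e"
    using solution_init[OF X e] by simp
  have "sum (X t) E \<le> sum (X 0) E * exp (growth_rate * t)"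
  proof (rule gronwall_nonneg_growth[OF t0])
    fix s assume s: "s \<in> {0..t}"
    show "((\<lambda>s. sum (X s) E) has_real_derivative (\<Sum>e\<in>E. flow_field e (X s))) (at s within {0..t})"
      by (intro DERIV_sum solution_deriv_Icc[OF X t s])
    have "(\<Sum>e\<in>E. flow_field e (X s)) \<le> (\<Sum>e\<in>E. 2 * card V * sum (X s) E)"
      using bounds(2)[OF s] by (intro sum_mono) simp
    then show "(\<Sum>e\<in>E. flow_field e (X s)) \<le> growth_rate * sum (X s) E"
      by (simp add: growth_rate_def algebra_simps)
  qed
  moreover have "sum (X 0) E = 1"
    using solution_init[OF X] init_sum by simp
  moreover have "X t e \<le> sum (X t) E"
    using finite_E less_imp_le[OF solution_pos[OF X t]] by (intro member_le_sum[OF e]) auto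
  ultimately show "X t e \<le> exp (growth_rate * t)"
    by simp
qed

definition min_init :: real where
  "min_init = Min (w\<^sub>0 ` E)"

lemma min_init: "0 < min_init" "e \<in> E \<Longrightarrow> min_init \<le> w\<^sub>0 e" "min_init \<le> 1"
proof -
  have "min_init \<in> w\<^sub>0 ` E"
    unfolding min_init_def using finite_E edges_nonempty by (intro Min_in) auto
  then obtain e where e: "e \<in> E" "min_init = w\<^sub>0 e"
    by blast
  show "0 < min_init"
    using e init_pos by simp
  have "w\<^sub>0 e \<le> sum w\<^sub>0 E"
    using finite_E init_pos by (intro member_le_sum[OF e(1)]) (auto intro: less_imp_le)
  then show "min_init \<le> 1"
    using e(2) init_sum by simp
  show "e \<in> E \<Longrightarrow> min_init \<le> w\<^sub>0 e" for e
    unfolding min_init_def using finite_E by (intro Min_le) auto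
qed

lemma solution_in_edge_box:
  assumes X: "solution T X" and t: "t \<in> time_interval T" and "t \<le> T'"
  shows "X t \<in> edge_box (min_init * exp (- 2 * T')) (exp (growth_rate * T'))"
  unfolding edge_box_def
proof (intro CollectI ballI conjI)
  fix e assume e: "e \<in> E"
  have "min_init * exp (- 2 * T') \<le> w\<^sub>0 e * exp (- 2 * t)"
    using min_init(1) min_init(2)[OF e] assms(3) by (intro mult_mono) auto
  then show "min_init * exp (- 2 * T') \<le> X t e"
    using solution_bounds(1)[OF X t e] by linarith
  have "exp (growth_rate * t) \<le> exp (growth_rate * T')"
    using growth_rate_nonneg assms(3) by (simp add: mult_left_mono)
  then show "X t e \<le> exp (growth_rate * T')"
    using solution_bounds(2)[OF X t e] by linarith
qed

lemma edge_box_bounds_ordered: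
  assumes "0 \<le> T"
  shows "min_init * exp (- 2 * T) \<le> exp (growth_rate * T)"
proof -
  have "min_init * exp (- 2 * T) \<le> 1 * 1"
    using assms min_init(1,3) by (intro mult_mono) auto
  also have "\<dots> \<le> exp (growth_rate * T)"
    using assms growth_rate_nonneg by simp
  finally show ?thesis .
qed

lemma solution_unique:
  assumes X: "solution T X" and Y: "solution T' Y"
    and t: "t \<in> time_interval T" "t \<in> time_interval T'" and e: "e \<in> E"
  shows "X t e = Y t e"
proof -
  have t0: "0 \<le> t"
    using t by (simp add: time_interval_def)
  let ?B = "edge_box (min_init * exp (- 2 * t)) (exp (growth_rate * t))"
  have "0 < min_init * exp (- 2 * t)"
    using min_init(1) by simp
  then obtain L where L: "0 \<le> L" "\<forall>e\<in>E. \<forall>w\<in>?B. \<forall>w'\<in>?B.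
      \<bar>flow_field e w - flow_field e w'\<bar> \<le> L * (\<Sum>j\<in>E. \<bar>w j - w' j\<bar>)"
    using flow_field_lipschitz edge_box_bounds_ordered[OF t0] by blast
  show ?thesis
  proof (rule ode_solution_unique[OF finite_E t0 L(2)[rule_format] _ _ _ _ e])
    show "X s \<in> ?B \<and> Y s \<in> ?B" if "s \<in> {0..t}" for s
    proof -
      have "s \<in> time_interval T" "s \<in> time_interval T'" "s \<le> t"
        using Icc_subset_time_interval[OF t(1)] Icc_subset_time_interval[OF t(2)] that by auto
      then show ?thesis
        using solution_in_edge_box[OF X] solution_in_edge_box[OF Y] by blast
    qed
    show "X 0 e = Y 0 e" if "e \<in> E" for e
      using solution_init[OF X that] solution_init[OF Y that] by simp
  qed (use solution_deriv_Icc[OF X t(1)] solution_deriv_Icc[OF Y t(2)] in auto)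
qed

text \<open>
  The box \<open>[a, b]\<close> is strictly larger than the box in which all solutions on \<open>[0, T)\<close> must remain.
  The clamped equation is solvable on \<open>[0, T]\<close>; if its solution \<open>X\<close> left the open box, then at the first
  such time \<open>\<tau>\<close> it would be a limit of values of a genuine solution on \<open>[0, \<tau>)\<close>. These values lie in the
  smaller closed box, because the shortest-path hypothesis applies to that short-lived solution, so
  \<open>X \<tau>\<close> lies there too, a contradiction.
\<close>

lemma solution_exists_on_bounded_interval:
  assumes T: "0 < T"
  obtains X where "solution (ereal T) X"
proof -
  define a where "a = min_init * exp (- 2 * T) / 2"
  define b where "b = exp (growth_rate * T) + 1"
  have a: "0 < a" "a < min_init * exp (- 2 * T)"
    using min_init(1) by (auto simp: a_def)
  have b: "exp (growth_rate * T) < b"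
    by (simp add: b_def)
  have ab: "a \<le> b"
    using a b edge_box_bounds_ordered[of T] T by simp
  obtain L where L: "0 \<le> L" "\<forall>e\<in>E. \<forall>w\<in>edge_box a b. \<forall>w'\<in>edge_box a b.
      \<bar>flow_field e w - flow_field e w'\<bar> \<le> L * (\<Sum>j\<in>E. \<bar>w j - w' j\<bar>)"
    using flow_field_lipschitz[OF a(1) ab] .
  \<comment> \<open>Values off \<open>E\<close> are left alone so that a weight function inside the box is literally unchanged.\<close>
  define clamp where "clamp w e = (if e \<in> E then max a (min b (w e)) else w e)" for w :: "'a set \<Rightarrow> real" and e
  have clamp_box: "clamp w \<in> edge_box a b" for w
    using ab by (simp add: edge_box_def clamp_def)
  have clamp_id: "clamp w = w" if "\<forall>e\<in>E. a < w e \<and> w e < b" for w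
    using that by (force simp: clamp_def max_def min_def)
  have clamp_contract: "(\<Sum>j\<in>E. \<bar>clamp w j - clamp w' j\<bar>) \<le> (\<Sum>j\<in>E. \<bar>w j - w' j\<bar>)" for w w'
    by (intro sum_mono) (auto simp: clamp_def)
  have lip: "\<bar>flow_field e (clamp w) - flow_field e (clamp w')\<bar> \<le> L * (\<Sum>j\<in>E. \<bar>w j - w' j\<bar>)"
    if "e \<in> E" for e w w'
    using L(2)[rule_format, OF that clamp_box clamp_box, of w w']
      mult_left_mono[OF clamp_contract L(1), of w w'] by linarith
  obtain X where X0: "\<forall>e\<in>E. X 0 e = w\<^sub>0 e" and X: "\<forall>e\<in>E. \<forall>t\<in>{0..T}.
      ((\<lambda>s. X s e) has_real_derivative flow_field e (clamp (X t))) (at t within {0..T})"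
    using picard_existence[OF finite_E less_imp_le[OF T] L(1) lip] .
  note X0 = X0[rule_format] and X = X[rule_format]
  have cont: "continuous_on {0..T} (\<lambda>t. X t e)" if "e \<in> E" for e
    using X[OF that] by (rule DERIV_continuous_on)
  have solution_until: "solution (ereal \<tau>) X"
    if \<tau>: "\<tau> \<le> T" and inside: "\<And>t e. \<lbrakk>0 \<le> t; t < \<tau>; e \<in> E\<rbrakk> \<Longrightarrow> a < X t e \<and> X t e < b" for \<tau>
    unfolding solution_iff time_interval_ereal
  proof (intro conjI ballI)
    fix t e assume t: "t \<in> {0..<\<tau>}" and e: "e \<in> E"
    show "0 < X t e"
      using inside[of t e] t e a(1) by auto
    have "clamp (X t) = X t"
      using inside t by (intro clamp_id) auto
    then show "((\<lambda>s. X s e) has_real_derivative flow_field e (X t)) (at t within {0..<\<tau>})"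
      using X[OF e, of t] t \<tau> by (auto intro: DERIV_subset)
  qed (use X0 in simp)
  define S where "S = (\<Union>e\<in>E. {t\<in>{0..T}. X t e \<le> a} \<union> {t\<in>{0..T}. b \<le> X t e})"
  have inside: "a < X t e \<and> X t e < b" if "0 \<le> t" "t \<le> T" "t \<notin> S" "e \<in> E" for t e
    using that by (force simp: S_def)
  have "S = {}"
  proof (rule ccontr)
    assume "S \<noteq> {}"
    have closed: "closed S"
      unfolding S_def
      by (intro closed_UN[OF finite_E] ballI closed_Un continuous_on_closed_Collect_le
          continuous_on_const cont closed_atLeastAtMost) assumption+
    have S_ge: "0 \<le> t" "t \<le> T" if "t \<in> S" for t
      using that by (auto simp: S_def)
    have bdd: "bdd_below S"
      using S_ge(1) by (rule bdd_belowI)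
    define \<tau> where "\<tau> = Inf S"
    have \<tau>_mem: "\<tau> \<in> S"
      unfolding \<tau>_def using closed_contains_Inf[OF \<open>S \<noteq> {}\<close> bdd closed] .
    have "0 \<notin> S"
    proof
      assume "0 \<in> S"
      then obtain e where e: "e \<in> E" "X 0 e \<le> a \<or> b \<le> X 0 e"
        by (auto simp: S_def)
      have "min_init * exp (- 2 * T) \<le> w\<^sub>0 e * 1"
        using min_init(1) min_init(2)[OF e(1)] T by (intro mult_mono) auto
      moreover have "w\<^sub>0 e \<le> 1"
        using e(1) init_sum finite_E init_pos member_le_sum[of e E w\<^sub>0] by (auto intro: less_imp_le)
      moreover have "1 \<le> exp (growth_rate * T)"
        using growth_rate_nonneg T by simp
      ultimately show False
        using e(2) X0[OF e(1)] a b by linarith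
    qed
    then have \<tau>: "0 < \<tau>" "\<tau> \<le> T"
      using S_ge[OF \<tau>_mem] \<tau>_mem by (auto simp: less_le)
    have sol: "solution (ereal \<tau>) X"
    proof (rule solution_until[OF \<tau>(2)])
      fix t e assume t: "0 \<le> t" "t < \<tau>" and e: "e \<in> E"
      have "t \<notin> S"
        using t(2) cInf_lower[OF _ bdd, of t] by (auto simp: \<tau>_def)
      then show "a < X t e \<and> X t e < b"
        using inside t \<tau>(2) e by simp
    qed
    obtain e where e: "e \<in> E" "X \<tau> e \<le> a \<or> b \<le> X \<tau> e"
      using \<tau>_mem by (auto simp: S_def)
    have closure: "closure {0..<\<tau>} = {0..\<tau>}"
      using \<tau>(1) by simp
    have cont': "continuous_on (closure {0..<\<tau>}) (\<lambda>t. X t e)"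
      unfolding closure using cont[OF e(1)] by (rule continuous_on_subset) (use \<tau>(2) in auto)
    have \<tau>_closure: "\<tau> \<in> closure {0..<\<tau>}"
      unfolding closure using \<tau>(1) by simp
    have box: "X t \<in> edge_box (min_init * exp (- 2 * T)) (exp (growth_rate * T))" if "t \<in> {0..<\<tau>}" for t
      using that \<tau>(2) by (intro solution_in_edge_box[OF sol]) (auto simp: time_interval_ereal)
    have "min_init * exp (- 2 * T) \<le> X \<tau> e"
      using cont' \<tau>_closure by (rule continuous_ge_on_closure) (use box e(1) in \<open>auto simp: edge_box_def\<close>)
    moreover have "X \<tau> e \<le> exp (growth_rate * T)"
      using cont' \<tau>_closure by (rule continuous_le_on_closure) (use box e(1) in \<open>auto simp: edge_box_def\<close>)
    ultimately show False
      using e(2) a b by linarith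
  qed
  then have "solution (ereal T) X"
    using inside by (intro solution_until) auto
  then show thesis using that by blast
qed

text \<open>
  At time \<open>t\<close> the global solution takes the value of the solution on \<open>[0, n + 1)\<close> with
  \<open>n = \<lfloor>t\<rfloor>\<close>. By uniqueness it agrees on the edges with that solution on all of \<open>[0, n + 1)\<close>, a
  neighbourhood of \<open>t\<close> in \<open>[0, \<infinity>)\<close>, and so has the same derivative there.
\<close>

lemma solution_exists_forever:
  obtains X where "solution \<infinity> X"
proof -
  have "\<exists>X. solution (ereal (real n + 1)) X" for n :: nat
    using solution_exists_on_bounded_interval[of "real n + 1"] by (metis add_nonneg_pos of_nat_0_le_iff zero_less_one)
  then obtain Z where Z: "\<And>n :: nat. solution (ereal (real n + 1)) (Z n)"
    by metis
  define X where "X t = Z (nat \<lfloor>t\<rfloor>) t" for t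
  have agree: "X t e = Z n t e" if "0 \<le> t" "t < real n + 1" "e \<in> E" for t n e
    unfolding X_def
  proof (rule solution_unique[OF Z Z _ _ that(3)])
    show "t \<in> time_interval (ereal (real (nat \<lfloor>t\<rfloor>) + 1))"
      using that(1) by (simp add: time_interval_def)
    show "t \<in> time_interval (ereal (real n + 1))"
      using that(1,2) by (simp add: time_interval_def)
  qed
  have "solution \<infinity> X"
    unfolding solution_iff time_interval_infinity
  proof (intro conjI ballI)
    show "X 0 e = w\<^sub>0 e" if "e \<in> E" for e
      using that solution_init[OF Z[of 0]] by (simp add: X_def)
    fix t :: real and e assume t: "t \<in> {0..}" and e: "e \<in> E"
    define n where "n = nat \<lfloor>t\<rfloor>"
    have t_less: "t < real n + 1"
      using t unfolding n_def by (simp; linarith)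
    have mem: "t \<in> time_interval (ereal (real n + 1))"
      using t t_less by (simp add: time_interval_ereal)
    have X_t: "X t = Z n t"
      by (simp add: X_def n_def)
    show "0 < X t e"
      unfolding X_t using solution_pos[OF Z mem e] .
    have "((\<lambda>s. Z n s e) has_real_derivative flow_field e (X t)) (at t within {0..<real n + 1})"
      using solution_deriv[OF Z mem e] by (simp add: X_t time_interval_ereal)
    then have "((\<lambda>s. X s e) has_real_derivative flow_field e (X t)) (at t within {0..<real n + 1})"
      by (rule has_field_derivative_transform_within[where d = 1])
         (use t t_less e agree in auto)
    moreover have "at t within {0..<real n + 1} = at t within {0..}"
      by (rule at_within_nhd[where S = "{..<real n + 1}"]) (use t_less in auto)
    ultimately show "((\<lambda>s. X s e) has_real_derivative flow_field e (X t)) (at t within {0..})"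
      by simp
  qed
  then show thesis using that by blast
qed

end

theorem corollary1:
  fixes \<gamma> :: "real \<Rightarrow> real"
    and V :: "'a set" and E :: "'a set set" and w\<^sub>0 :: "'a set \<Rightarrow> real"
  assumes gamma_pos: "\<And>x. 0 < x \<Longrightarrow> 0 < \<gamma> x"
    and gamma_inj: "inj_on \<gamma> {0<..}"
    and gamma_scale: "\<And>(V' :: 'a set) E' w c x y.
      \<lbrakk>finite_connected_simple_graph V' E'; \<forall>e\<in>E'. 0 < w e; 0 < c; x \<in> V'; y \<in> V'; x \<noteq> y\<rbrakk>
      \<Longrightarrow> olly_curvature \<gamma> V' E' (\<lambda>e. c * w e) x y = olly_curvature \<gamma> V' E' w x y"
    and gamma_lipschitz: "\<And>\<delta>. 0 < \<delta> \<Longrightarrow> \<exists>L. L-lipschitz_on {\<delta>..1} \<gamma>"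
    and graph: "finite_connected_simple_graph V E"
    and edges_nonempty: "E \<noteq> {}"
    and init_pos: "\<forall>e\<in>E. 0 < w\<^sub>0 e"
    and init_sum: "(\<Sum>e\<in>E. w\<^sub>0 e) = 1"
    and edges_shortest: "\<And>T X t u v.
      \<lbrakk>0 < T; ricci_flow_solution \<gamma> V E w\<^sub>0 T X; t \<in> time_interval T; {u, v} \<in> E\<rbrakk>
      \<Longrightarrow> X t {u, v} = wdist E (X t) u v"
  shows "\<exists>X. ricci_flow_solution \<gamma> V E w\<^sub>0 \<infinity> X \<and>
    (\<forall>Y. ricci_flow_solution \<gamma> V E w\<^sub>0 \<infinity> Y \<longrightarrow> (\<forall>t\<ge>0. \<forall>e\<in>E. Y t e = X t e))"
proof -
  interpret finite_graph V E
    using graph by unfold_locales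
  interpret ricci_flow V E \<gamma> w\<^sub>0
  proof unfold_locales
    show "olly_curvature \<gamma> V E (\<lambda>e. c * w e) x y = olly_curvature \<gamma> V E w x y"
      if "\<forall>e\<in>E. 0 < w e" "0 < c" "{x, y} \<in> E" for w c x y
      using that edge_ends[OF that(3)] by (intro gamma_scale graph)
  qed (fact gamma_pos gamma_lipschitz edges_nonempty init_pos init_sum edges_shortest)+
  obtain X where X: "solution \<infinity> X"
    using solution_exists_forever .
  moreover have "Y t e = X t e" if "solution \<infinity> Y" "0 \<le> t" "e \<in> E" for Y t e
    using solution_unique[OF that(1) X] that(2,3) by (simp add: time_interval_infinity)
  ultimately show ?thesis by blast
qed

end
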